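(* Let $\Gamma$ be a finite, irreducible Coxeter group of rank $\mathrm{rk}(\Gamma)=k$ with Coxeter generators $S=\{s_1,\dots,s_k\}$, and let $\Psi_\Delta:\mathcal{F}_0\to\mathrm{int}(\Delta)$ (a bijection) and $\Psi_\lambda:\mathcal{F}_0\to(0,1)$ be the maps defined in the context. Then the map $\Psi_\lambda\circ\Psi_\Delta^{-1}:\mathrm{int}(\Delta)\to(0,1)$ coincides with the second highest eigenvalue function $\lambda_1:\mathrm{int}(\Delta)\to(0,1)$. Consequently, the second highest eigenvalue $\lambda_1(X)$ of $P_X$ always has multiplicity $\ge\mathrm{rk}(\Gamma)$.
   Context: $\Gamma=\langle s_1,\dots,s_k\mid(s_is_j)^{m_{ij}}=e\rangle$ is a finite irreducible Coxeter group of rank $k$, $m_{ij}=m_{ji}\ge2$ for $i\ne j$, $s_i^2=e$, realised as a finite reflection group $\Gamma\hookrightarrow O(k)$: $s_j$ acts as $\sigma_j(v)=v-2\langle v,n_j\rangle n_j$, with unit simple roots $n_1,\dots,n_k$, $\langle n_i,n_j\rangle=-\cos\frac{\pi}{m_{ij}}$ for $i\ne j$, ordered so that $V=\det(n_1,\dots,n_k)>0$. Let $M=(\langle n_i,n_j\rangle)_{i,j}$. Let $p_1,\dots,p_k\in\mathbb{R}^k$ be the vectors with $\langle n_i,p_j\rangle=V\delta_{ij}$, and $\mathcal{F}_0=\{\sum_j\alpha_jp_j\mid\alpha_1,\dots,\alpha_k>0\}\cap S^{k-1}$ with $S^{k-1}\subset\mathbb{R}^k$ the unit sphere. $\Delta=\{(x_1,\dots,x_k)\mid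 x_j\ge0,\ \sum_jx_j=1\}$, and $\mathrm{int}(\Delta)$ is the subset where all $x_j>0$. For $p=\sum_j\alpha_jp_j\in\mathcal{F}_0$ define $$(x_1',\dots,x_k')^\top=V\,\mathrm{diag}(\alpha_1,\dots,\alpha_k)^{-1}M^{-1}(\alpha_1,\dots,\alpha_k)^\top,\qquad\lambda'=x_1'+\dots+x_k'-2V,$$ and $$\Psi_\Delta(p)=\frac{1}{\sum_jx_j'}(x_1',\dots,x_k'),\qquad\Psi_\lambda(p)=\frac{\lambda'}{\sum_jx_j'}.$$ Then $X=(x_1,\dots,x_k)=\Psi_\Delta(p)$ and $\lambda=\Psi_\lambda(p)$ satisfy $\lambda p=\sum_jx_j\sigma_j(p)$, and $\Psi_\Delta:\mathcal{F}_0\to\mathrm{int}(\Delta)$ is bijective. For $X\in\Delta$, $P_X$ is the operator $P_Xf(\gamma)=\sum_{j=1}^kx_jf(\gamma s_j)$ on real functions $f$ on $\Gamma$ (the vertex set of the Cayley graph $\mathrm{Cay}(\Gamma,S)$, with edges $\{\gamma,\gamma s_j\}$); its eigenvalues counted with multiplicity are $1=\lambda_0(X)\ge\lambda_1(X)\ge\cdots$.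
   Formalization: The claim that the two maps take values in (0,1) is stated only for rank k ≥ 2, since for k = 1 (Γ of order 2) both equal −1; every other claim is stated for all ranks k ≥ 1. *)

theory Defs
  imports "HOL-Analysis.Analysis" "HOL-Algebra.Group" "HOL-Library.Function_Algebras"
    "HOL-Library.Multiset"
begin

text \<open>Group presentations. A word in the free group on \<^typ>\<open>'i\<close> is a list of signed letters:
  \<^term>\<open>(i, True)\<close> is the generator with index \<^term>\<open>i\<close>, and \<^term>\<open>(i, False)\<close> its inverse.\<close>

fun letter_val :: "('g, 'b) monoid_scheme \<Rightarrow> ('i \<Rightarrow> 'g) \<Rightarrow> 'i \<times> bool \<Rightarrow> 'g" where
  "letter_val G s (i, b) = (if b then s i else inv\<^bsub>G\<^esub> (s i))"

definition word_val :: "('g, 'b) monoid_scheme \<Rightarrow> ('i \<Rightarrow> 'g) \<Rightarrow> ('i \<times> bool) list \<Rightarrow> 'g" where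
  "word_val G s w = foldr (\<lambda>l g. letter_val G s l \<otimes>\<^bsub>G\<^esub> g) w \<one>\<^bsub>G\<^esub>"

text \<open>Equality of words in the group presented by the relators \<^term>\<open>R\<close>.\<close>

inductive pres_equiv :: "('i \<times> bool) list set \<Rightarrow> ('i \<times> bool) list \<Rightarrow> ('i \<times> bool) list \<Rightarrow> bool"
  for R where
  refl: "pres_equiv R u u"
| sym: "pres_equiv R u v \<Longrightarrow> pres_equiv R v u"
| trans: "pres_equiv R u v \<Longrightarrow> pres_equiv R v w \<Longrightarrow> pres_equiv R u w"
| cancel: "pres_equiv R (u @ [(i, b), (i, \<not> b)] @ v) (u @ v)"
| relator: "r \<in> R \<Longrightarrow> pres_equiv R (u @ r @ v) (u @ v)"

definition presented_by ::
    "('g, 'b) monoid_scheme \<Rightarrow> ('i \<Rightarrow> 'g) \<Rightarrow> ('i \<times> bool) list set \<Rightarrow> bool" where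
  "presented_by G s R \<longleftrightarrow>
     group G \<and> (\<forall>i. s i \<in> carrier G) \<and>
     (\<forall>g\<in>carrier G. \<exists>w. word_val G s w = g) \<and>
     (\<forall>u v. word_val G s u = word_val G s v \<longleftrightarrow> pres_equiv R u v)"

text \<open>Coxeter systems. Only finite groups are treated below, so the entry \<open>\<infinity>\<close> is not needed in
  Coxeter matrices. The diagonal entries \<open>m i i = 1\<close> encode \<open>s\<^sub>i\<^sup>2 = e\<close>.\<close>

definition coxeter_matrix :: "('i \<Rightarrow> 'i \<Rightarrow> nat) \<Rightarrow> bool" where
  "coxeter_matrix m \<longleftrightarrow>
     (\<forall>i. m i i = 1) \<and> (\<forall>i j. i \<noteq> j \<longrightarrow> m i j \<ge> 2 \<and> m i j = m j i)"

definition coxeter_relators :: "('i \<Rightarrow> 'i \<Rightarrow> nat) \<Rightarrow> ('i \<times> bool) list set" where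
  "coxeter_relators m = {concat (replicate (m i j) [(i, True), (j, True)]) | i j. True}"

definition coxeter_system ::
    "('g, 'b) monoid_scheme \<Rightarrow> ('i \<Rightarrow> 'g) \<Rightarrow> ('i \<Rightarrow> 'i \<Rightarrow> nat) \<Rightarrow> bool" where
  "coxeter_system G s m \<longleftrightarrow> coxeter_matrix m \<and> presented_by G s (coxeter_relators m)"

text \<open>Irreducibility: the generators do not split into two nonempty commuting classes, that is,
  the Coxeter graph is connected.\<close>

definition irreducible_coxeter :: "('i \<Rightarrow> 'i \<Rightarrow> nat) \<Rightarrow> bool" where
  "irreducible_coxeter m \<longleftrightarrow>
     \<not> (\<exists>I. I \<noteq> {} \<and> I \<noteq> UNIV \<and> (\<forall>i\<in>I. \<forall>j\<in>- I. m i j = 2))"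

text \<open>Simple roots. The rank \<open>k\<close> is \<^term>\<open>CARD('n)\<close>; the type \<^typ>\<open>'n\<close> indexes both the
  generators and the coordinates of the Euclidean space.\<close>

definition root_det :: "('n::finite \<Rightarrow> real ^ 'n) \<Rightarrow> real" where
  "root_det n = det (\<chi> i. n i)"

definition simple_roots :: "('n::finite \<Rightarrow> 'n \<Rightarrow> nat) \<Rightarrow> ('n \<Rightarrow> real ^ 'n) \<Rightarrow> bool" where
  "simple_roots m n \<longleftrightarrow>
     (\<forall>i. norm (n i) = 1) \<and>
     (\<forall>i j. i \<noteq> j \<longrightarrow> n i \<bullet> n j = - cos (pi / real (m i j))) \<and>
     root_det n > 0"

definition root_gram :: "('n::finite \<Rightarrow> real ^ 'n) \<Rightarrow> real ^ 'n ^ 'n" where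
  "root_gram n = (\<chi> i j. n i \<bullet> n j)"

text \<open>Since \<^term>\<open>root_det n > 0\<close>, the roots form a basis; so the vectors \<open>p\<^sub>j\<close> and
  the coordinates of a point with respect to them exist and are unique.\<close>

definition dual_vec :: "('n::finite \<Rightarrow> real ^ 'n) \<Rightarrow> 'n \<Rightarrow> real ^ 'n" where
  "dual_vec n j = (THE p. \<forall>i. n i \<bullet> p = (if i = j then root_det n else 0))"

definition dual_coords :: "('n::finite \<Rightarrow> real ^ 'n) \<Rightarrow> real ^ 'n \<Rightarrow> real ^ 'n" where
  "dual_coords n p = (THE \<alpha>. p = (\<Sum>j\<in>UNIV. \<alpha> $ j *\<^sub>R dual_vec n j))"

definition F0 :: "('n::finite \<Rightarrow> real ^ 'n) \<Rightarrow> (real ^ 'n) set" where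
  "F0 n = {\<Sum>j\<in>UNIV. \<alpha> $ j *\<^sub>R dual_vec n j | \<alpha> :: real ^ 'n. \<forall>j. \<alpha> $ j > 0} \<inter> sphere 0 1"

definition std_simplex :: "(real ^ 'n::finite) set" where
  "std_simplex = {x. (\<forall>j. x $ j \<ge> 0) \<and> (\<Sum>j\<in>UNIV. x $ j) = 1}"

definition int_simplex :: "(real ^ 'n::finite) set" where
  "int_simplex = {x \<in> std_simplex. \<forall>j. x $ j > 0}"

definition diag_mat :: "real ^ 'n::finite \<Rightarrow> real ^ 'n ^ 'n" where
  "diag_mat a = (\<chi> i j. if i = j then a $ i else 0)"

definition x_prime :: "('n::finite \<Rightarrow> real ^ 'n) \<Rightarrow> real ^ 'n \<Rightarrow> real ^ 'n" where
  "x_prime n p = (let \<alpha> = dual_coords n p in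
     root_det n *\<^sub>R (matrix_inv (diag_mat \<alpha>) *v (matrix_inv (root_gram n) *v \<alpha>)))"

definition lambda_prime :: "('n::finite \<Rightarrow> real ^ 'n) \<Rightarrow> real ^ 'n \<Rightarrow> real" where
  "lambda_prime n p = (\<Sum>j\<in>UNIV. x_prime n p $ j) - 2 * root_det n"

definition Psi_Delta :: "('n::finite \<Rightarrow> real ^ 'n) \<Rightarrow> real ^ 'n \<Rightarrow> real ^ 'n" where
  "Psi_Delta n p = (1 / (\<Sum>j\<in>UNIV. x_prime n p $ j)) *\<^sub>R x_prime n p"

definition Psi_lambda :: "('n::finite \<Rightarrow> real ^ 'n) \<Rightarrow> real ^ 'n \<Rightarrow> real" where
  "Psi_lambda n p = lambda_prime n p / (\<Sum>j\<in>UNIV. x_prime n p $ j)"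

text \<open>The weighted Cayley graph operator. A real function on the group is represented by its
  extension by \<open>0\<close> to the whole type.\<close>

definition cayley_op ::
    "('g, 'b) monoid_scheme \<Rightarrow> ('n::finite \<Rightarrow> 'g) \<Rightarrow> real ^ 'n \<Rightarrow> ('g \<Rightarrow> real) \<Rightarrow> 'g \<Rightarrow> real" where
  "cayley_op G s X f =
     (\<lambda>g. if g \<in> carrier G then \<Sum>j\<in>UNIV. X $ j * f (g \<otimes>\<^bsub>G\<^esub> s j) else 0)"

definition cayley_eigenspace ::
    "('g, 'b) monoid_scheme \<Rightarrow> ('n::finite \<Rightarrow> 'g) \<Rightarrow> real ^ 'n \<Rightarrow> real \<Rightarrow> ('g \<Rightarrow> real) set" where
  "cayley_eigenspace G s X \<mu> =
     {f. (\<forall>g. g \<notin> carrier G \<longrightarrow> f g = 0) \<and> cayley_op G s X f = (\<lambda>g. \<mu> * f g)}"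

definition cayley_eigenvalues ::
    "('g, 'b) monoid_scheme \<Rightarrow> ('n::finite \<Rightarrow> 'g) \<Rightarrow> real ^ 'n \<Rightarrow> real set" where
  "cayley_eigenvalues G s X = {\<mu>. \<exists>f\<in>cayley_eigenspace G s X \<mu>. \<exists>g. f g \<noteq> 0}"

text \<open>For an involutive generator, right translation is self-adjoint. So the operator is
  diagonalisable over the reals, and the multiplicity of an eigenvalue is the dimension of its
  eigenspace.\<close>

definition cayley_mult ::
    "('g, 'b) monoid_scheme \<Rightarrow> ('n::finite \<Rightarrow> 'g) \<Rightarrow> real ^ 'n \<Rightarrow> real \<Rightarrow> nat" where
  "cayley_mult G s X \<mu> =
     vector_space.dim (\<lambda>(c::real) (f::'g \<Rightarrow> real). (\<lambda>g. c * f g)) (cayley_eigenspace G s X \<mu>)"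

text \<open>All eigenvalues, repeated according to multiplicity, in descending order; indices
  start at \<open>0\<close>.\<close>

definition cayley_spectrum ::
    "('g, 'b) monoid_scheme \<Rightarrow> ('n::finite \<Rightarrow> 'g) \<Rightarrow> real ^ 'n \<Rightarrow> real list" where
  "cayley_spectrum G s X =
     rev (sorted_list_of_multiset
       (\<Sum>\<mu>\<in>cayley_eigenvalues G s X. replicate_mset (cayley_mult G s X \<mu>) \<mu>))"

definition cayley_lambda ::
    "('g, 'b) monoid_scheme \<Rightarrow> ('n::finite \<Rightarrow> 'g) \<Rightarrow> nat \<Rightarrow> real ^ 'n \<Rightarrow> real" where
  "cayley_lambda G s i X = cayley_spectrum G s X ! i"

end

theory Submission
  imports Defs
begin

text \<open>Write \<open>D\<^sub>i f(\<gamma>) = f(\<gamma>) - f(\<gamma>s\<^sub>i)\<close>, so that \<open>L = 1 - P\<^sub>X = \<Sum>x\<^sub>i D\<^sub>i\<close>. A discrete Wirtinger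
  inequality on cycles of length \<open>2 m\<^sub>i\<^sub>j\<close> bounds the mixed terms \<open>\<langle>D\<^sub>i f, D\<^sub>j f\<rangle>\<close> in
  \<open>\<langle>L f, L f\<rangle>\<close> from below by \<open>\<parallel>D\<^sub>i f\<parallel>\<^sup>2\<close> and \<open>\<parallel>D\<^sub>j f\<parallel>\<^sup>2\<close>, with weights that may be rescaled
  against each other. Choosing the weights from the point \<open>p\<close> with \<open>\<Psi>\<^sub>\<Delta> p = X\<close> yields
  \<open>\<langle>L f, L f\<rangle> \<ge> (1 - \<lambda>) \<langle>L f, f\<rangle>\<close> for \<open>\<lambda> = \<Psi>\<^sub>\<lambda> p\<close>, so no eigenvalue lies strictly between
  \<open>\<lambda>\<close> and \<open>1\<close>. Conversely, the functions \<open>\<gamma> \<mapsto> \<langle>v, \<gamma>p\<rangle>\<close> form a \<open>k\<close>-dimensional space of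
  eigenfunctions for \<open>\<lambda>\<close>, by irreducibility of the reflection representation. On the boundary of
  the simplex the same construction, applied to some \<open>p\<^sub>j\<close>, shows that the eigenvalue \<open>1\<close> has
  multiplicity at least \<open>k\<close>. Bijectivity of \<open>\<Psi>\<^sub>\<Delta>\<close> is a Perron-Frobenius argument for the Gram
  matrix.\<close>

section \<open>A weighted Wirtinger inequality on even cycles\<close>

lemma sum_cycle_shift:
  fixes g :: "nat \<Rightarrow> 'a::ab_group_add"
  assumes "g N = g 0"
  shows "(\<Sum>k<N. g (Suc k)) = (\<Sum>k<N. g k)"
  using sum.lessThan_Suc[of g N] sum.lessThan_Suc_shift[of g N] assms by simp

lemma sum_double:
  fixes g :: "nat \<Rightarrow> 'a::comm_monoid_add"
  shows "(\<Sum>k<2*m. g k) = (\<Sum>l<m. g (2*l)) + (\<Sum>l<m. g (Suc (2*l)))"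
  by (induction m) (simp_all add: algebra_simps)

text \<open>The positive solution \<open>sin (\<pi> k / m)\<close> of the eigenvalue equation on the path, with zero
  boundary values, serves as ground state.\<close>

lemma path_product_sum_le:
  fixes d :: "nat \<Rightarrow> real"
  assumes m: "m \<ge> 2" and d0: "d 0 = 0" and dm: "d m = 0"
  shows "(\<Sum>k<m. d k * d (Suc k)) \<le> cos (pi / m) * (\<Sum>k<m. (d k)\<^sup>2)"
proof -
  define \<theta> where "\<theta> = pi / m"
  define s where "s k = sin (real k * \<theta>)" for k
  have s_pos: "s k > 0" if "0 < k" "k < m" for k
    unfolding s_def \<theta>_def using that m by (intro sin_gt_zero) (auto simp: field_simps)
  have rec: "s (Suc (Suc k)) + s k = 2 * cos \<theta> * s (Suc k)" for k
  proof -
    have "s (Suc (Suc k)) = sin (real (Suc k) * \<theta> + \<theta>)" "s k = sin (real (Suc k) * \<theta> - \<theta>)"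
      by (simp_all add: s_def algebra_simps)
    then show ?thesis by (simp add: sin_add sin_diff s_def)
  qed
  have s0: "s 0 = 0" and sm: "s m = 0" using m by (simp_all add: s_def \<theta>_def)
  \<comment> \<open>The last term is the part of the next square not yet spent. At the final edge
    \<open>d m = 0\<close>, and \<open>s m = 0\<close> makes the ratio equal to
    \<open>2 * cos \<theta>\<close>, so this term becomes the missing summand.\<close>
  have partial: "2 * (\<Sum>l<Suc k. d l * d (Suc l)) \<le>
      2 * cos \<theta> * (\<Sum>l<Suc k. (d l)\<^sup>2) + (d (Suc k))\<^sup>2 * (s k / s (Suc k))"
    if "Suc k < m" for k
    using that
  proof (induction k)
    case 0
    then show ?case using d0 s0 by simp
  next
    case (Suc k)
    have pos: "s (Suc k) > 0" "s (Suc (Suc k)) > 0" using s_pos Suc.prems by auto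
    define r where "r = s (Suc (Suc k)) / s (Suc k)"
    have r: "r > 0" "s k / s (Suc k) = 2 * cos \<theta> - r" "s (Suc k) / s (Suc (Suc k)) = 1 / r"
      using pos rec[of k] by (simp_all add: r_def field_simps)
    \<comment> \<open>Weighted AM-GM, with equality exactly when \<open>d\<close> changes by the
      same ratio as the ground state \<open>s\<close>.\<close>
    have "0 \<le> (sqrt r * d (Suc k) - d (Suc (Suc k)) / sqrt r)\<^sup>2" by simp
    also have "\<dots> = r * (d (Suc k))\<^sup>2 - 2 * d (Suc k) * d (Suc (Suc k)) + (d (Suc (Suc k)))\<^sup>2 * (1 / r)"
      using r(1) by (simp add: power2_diff power_mult_distrib power_divide)
    finally have am_gm: "2 * d (Suc k) * d (Suc (Suc k)) \<le>
        r * (d (Suc k))\<^sup>2 + (d (Suc (Suc k)))\<^sup>2 * (1 / r)" by linarith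
    have "2 * (\<Sum>l<Suc k. d l * d (Suc l)) \<le>
        2 * cos \<theta> * (\<Sum>l<Suc k. (d l)\<^sup>2) + (d (Suc k))\<^sup>2 * (2 * cos \<theta> - r)"
      using Suc r by simp
    then show ?case using am_gm by (simp add: r(3) algebra_simps)
  qed
  obtain k where k: "m = Suc (Suc k)" using m by (metis add_2_eq_Suc le_Suc_ex)
  have "s k = 2 * cos \<theta> * s (Suc k)" using rec[of k] sm k by simp
  then have "s k / s (Suc k) = 2 * cos \<theta>" using s_pos[of "Suc k"] k by simp
  then show ?thesis using partial[of k] dm k by (simp add: \<theta>_def algebra_simps)
qed

text \<open>Subtracting a constant \<open>u\<close> and a multiple of the first cosine mode
  \<open>h\<close> leaves a function \<open>d\<close> vanishing at the antipodal points
  \<open>0\<close> and \<open>m\<close>. The cycle then splits into two paths with zero boundary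
  values. The mode \<open>h\<close> attains equality, and the constant only helps because the mean
  is zero.\<close>

lemma cycle_product_sum_le:
  fixes e :: "nat \<Rightarrow> real"
  assumes m: "m \<ge> 2" and per: "\<And>k. e (k + 2 * m) = e k" and mean: "(\<Sum>k<2*m. e k) = 0"
  shows "(\<Sum>k<2*m. e k * e (Suc k)) \<le> cos (pi / m) * (\<Sum>k<2*m. (e k)\<^sup>2)"
proof -
  define N where "N = 2 * m"
  define c where "c = cos (pi / m)"
  define h where "h k = cos (real k * (pi / m))" for k
  define u where "u = (e 0 + e m) / 2"
  define b where "b = (e 0 - e m) / 2"
  define d where "d k = e k - u - b * h k" for k
  have c: "c < 1" unfolding c_def using m cos_monotone_0_pi[of 0 "pi / m"] by (simp add: field_simps)
  have h0: "h 0 = 1" and hm: "h m = -1" using m by (simp_all add: h_def)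
  have hper: "h (k + N) = h k" for k
  proof -
    have "real (k + N) * (pi / m) = real k * (pi / m) + 2 * pi"
      using m by (simp add: N_def field_simps)
    then show ?thesis by (simp add: h_def)
  qed
  have hrec: "h (Suc (Suc k)) + h k = 2 * c * h (Suc k)" for k
  proof -
    have "h (Suc (Suc k)) = cos (real (Suc k) * (pi / m) + pi / m)"
      "h k = cos (real (Suc k) * (pi / m) - pi / m)"
      by (simp_all add: h_def algebra_simps add_divide_distrib)
    then show ?thesis by (simp add: cos_add cos_diff h_def c_def)
  qed
  have eper: "e (k + N) = e k" for k using per by (simp add: N_def)
  have dper: "d (k + N) = d k" for k by (simp add: d_def eper hper)
  have shift: "(\<Sum>k<N. g (Suc k)) = (\<Sum>k<N. g k)" if "\<And>k. g (k + N) = g k" for g :: "nat \<Rightarrow> real"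
    using sum_cycle_shift[of g N] that[of 0] by simp
  \<comment> \<open>\<open>h\<close> is an eigenfunction, for \<open>2 * c\<close>, of the sum of
    the two cyclic shifts, which is self-adjoint.\<close>
  have orth: "(\<Sum>k<N. g k * h (Suc k) + h k * g (Suc k)) = 2 * c * (\<Sum>k<N. g k * h k)"
    if g: "\<And>k. g (k + N) = g k" for g
  proof -
    have "(\<Sum>k<N. g k * h (Suc k)) = (\<Sum>k<N. g (Suc k) * h (Suc (Suc k)))"
      using shift[of "\<lambda>k. g k * h (Suc k)"] g hper[of "Suc k" for k] by simp
    then have "(\<Sum>k<N. g k * h (Suc k) + h k * g (Suc k)) =
        (\<Sum>k<N. g (Suc k) * (h (Suc (Suc k)) + h k))"
      by (simp add: sum.distrib algebra_simps)
    also have "\<dots> = (\<Sum>k<N. 2 * c * (g (Suc k) * h (Suc k)))"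
      by (simp add: hrec mult_ac)
    also have "\<dots> = 2 * c * (\<Sum>k<N. g (Suc k) * h (Suc k))"
      by (simp add: sum_distrib_left)
    also have "(\<Sum>k<N. g (Suc k) * h (Suc k)) = (\<Sum>k<N. g k * h k)"
      using shift[of "\<lambda>k. g k * h k"] g hper by simp
    finally show ?thesis .
  qed
  have hsum: "(\<Sum>k<N. h k) = 0"
  proof -
    have "2 * (\<Sum>k<N. h k) = 2 * c * (\<Sum>k<N. h k)"
      using orth[of "\<lambda>_. 1"] shift[of h] hper by (simp add: sum.distrib)
    then show ?thesis using c by simp
  qed
  have hh: "(\<Sum>k<N. h k * h (Suc k)) = c * (\<Sum>k<N. (h k)\<^sup>2)"
    using orth[of h] hper by (simp add: power2_eq_square flip: sum_distrib_left)
  have dsum: "(\<Sum>k<N. d k) = - (real N * u)"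
    using mean hsum by (simp add: d_def sum_subtractf flip: sum_distrib_left N_def)
  have "(\<Sum>k<N. d k * d (Suc k)) \<le> c * (\<Sum>k<N. (d k)\<^sup>2)"
  proof -
    have "d 0 = 0" "d m = 0" by (simp_all add: d_def u_def b_def h0 hm field_simps)
    moreover have "d (m + m) = 0" using dper[of 0] \<open>d 0 = 0\<close> by (simp add: N_def mult_2)
    ultimately have "(\<Sum>k<m. d k * d (Suc k)) \<le> c * (\<Sum>k<m. (d k)\<^sup>2)"
      "(\<Sum>k<m. d (m + k) * d (Suc (m + k))) \<le> c * (\<Sum>k<m. (d (m + k))\<^sup>2)"
      using path_product_sum_le[of m d] path_product_sum_le[of m "\<lambda>k. d (m + k)"] m
      by (simp_all add: c_def)
    moreover have "(\<Sum>k<m + l. g k) = (\<Sum>k<m. g k) + (\<Sum>k<l. g (m + k))" for g :: "nat \<Rightarrow> real" and l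
      by (induction l) simp_all
    ultimately show ?thesis by (simp add: distrib_left N_def mult_2)
  qed
  \<comment> \<open>All terms with \<open>h\<close> cancel. The constant contributes
    \<open>(1 - c) * (2 * u * (\<Sum>k<N. d k) + N * u^2)\<close>, which \<open>dsum\<close> turns
    into a nonpositive quantity.\<close>
  moreover have "(\<Sum>k<N. e k * e (Suc k)) - c * (\<Sum>k<N. (e k)\<^sup>2) =
      (\<Sum>k<N. d k * d (Suc k)) - c * (\<Sum>k<N. (d k)\<^sup>2) - (1 - c) * (real N * u\<^sup>2)"
  proof -
    have e: "e k = d k + u + b * h k" for k by (simp add: d_def)
    have d': "(\<Sum>k<N. d (Suc k)) = (\<Sum>k<N. d k)" "(\<Sum>k<N. h (Suc k)) = (\<Sum>k<N. h k)"
      using shift dper hper by blast+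
    have ee: "(\<Sum>k<N. e k * e (Suc k)) = (\<Sum>k<N. d k * d (Suc k)) + u * (\<Sum>k<N. d k)
        + u * (\<Sum>k<N. d (Suc k)) + real N * u\<^sup>2 + b * (\<Sum>k<N. d k * h (Suc k) + h k * d (Suc k))
        + u * b * (\<Sum>k<N. h k) + u * b * (\<Sum>k<N. h (Suc k)) + b\<^sup>2 * (\<Sum>k<N. h k * h (Suc k))"
      unfolding e by (simp add: algebra_simps sum.distrib sum_distrib_left power2_eq_square)
    have e2: "(\<Sum>k<N. (e k)\<^sup>2) = (\<Sum>k<N. (d k)\<^sup>2) + 2 * u * (\<Sum>k<N. d k) + real N * u\<^sup>2
        + 2 * b * (\<Sum>k<N. d k * h k) + 2 * u * b * (\<Sum>k<N. h k) + b\<^sup>2 * (\<Sum>k<N. (h k)\<^sup>2)"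
      unfolding e by (simp add: algebra_simps sum.distrib sum_distrib_left power2_eq_square)
    show ?thesis
      unfolding ee e2 orth[of d, OF dper] d' hsum hh dsum
      by (simp add: algebra_simps power2_eq_square)
  qed
  moreover have "(1 - c) * (real N * u\<^sup>2) \<ge> 0" using c by simp
  ultimately have "(\<Sum>k<N. e k * e (Suc k)) \<le> c * (\<Sum>k<N. (e k)\<^sup>2)" by linarith
  then show ?thesis by (simp add: N_def c_def)
qed

text \<open>Removing the means of the even and the odd entries, which are opposite to each other, allows
  rescaling both classes independently.\<close>

lemma weighted_cycle_product_sum_le:
  fixes e :: "nat \<Rightarrow> real"
  assumes m: "m \<ge> 2" and t: "t > 0" and per: "\<And>k. e (k + 2 * m) = e k"
    and mean: "(\<Sum>k<2*m. e k) = 0"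
  shows "(\<Sum>k<2*m. e k * e (Suc k)) \<le>
    cos (pi / m) * (t * (\<Sum>l<m. (e (2*l))\<^sup>2) + (\<Sum>l<m. (e (Suc (2*l)))\<^sup>2) / t)"
proof -
  define c where "c = cos (pi / m)"
  define r where "r = sqrt t"
  define a where "a = (\<Sum>l<m. e (2*l)) / m"
  \<comment> \<open>Even entries have mean \<open>a\<close>, odd ones \<open>- a\<close>. Neighbours
    always have opposite parity, so the factors \<open>r\<close> and \<open>1 / r\<close> cancel in
    every product but give the weights \<open>t\<close> and \<open>1 / t\<close> in the
    squares.\<close>
  define d where "d k = (if even k then r * (e k - a) else (e k + a) / r)" for k
  have r: "r > 0" "r\<^sup>2 = t" using t by (simp_all add: r_def)
  have "pi / m \<le> pi / 2" using m by (intro divide_left_mono) simp_all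
  moreover have "0 \<le> pi / m" "0 \<le> pi / 2" by simp_all
  ultimately have c: "c \<ge> 0" unfolding c_def by (intro cos_ge_zero) linarith+
  have ev: "(\<Sum>l<m. e (2*l)) = m * a" using m by (simp add: a_def)
  then have od: "(\<Sum>l<m. e (Suc (2*l))) = - (m * a)" using mean by (simp add: sum_double)
  have "(\<Sum>l<m. d (2*l)) = r * ((\<Sum>l<m. e (2*l)) - m * a)"
    by (simp add: d_def sum_subtractf flip: sum_distrib_left)
  moreover have "(\<Sum>l<m. d (Suc (2*l))) = ((\<Sum>l<m. e (Suc (2*l))) + m * a) / r"
    by (simp add: d_def sum.distrib flip: sum_divide_distrib)
  ultimately have "(\<Sum>k<2*m. d k) = 0" by (simp add: sum_double ev od)
  moreover have "d (k + 2 * m) = d k" for k by (simp add: d_def per)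
  ultimately have "(\<Sum>k<2*m. d k * d (Suc k)) \<le> c * (\<Sum>k<2*m. (d k)\<^sup>2)"
    unfolding c_def using cycle_product_sum_le[OF m] by blast
  moreover have "(\<Sum>k<2*m. d k * d (Suc k)) = (\<Sum>k<2*m. e k * e (Suc k)) + 2 * m * a\<^sup>2"
  proof -
    have "e (2 * m) = e 0" using per[of 0] by simp
    then have s: "(\<Sum>l<m. e (Suc (Suc (2*l)))) = (\<Sum>l<m. e (2*l))"
      using sum_cycle_shift[of "\<lambda>l. e (2*l)" m] by simp
    have "(\<Sum>k<2*m. d k * d (Suc k)) =
        (\<Sum>l<m. (e (2*l) - a) * (e (Suc (2*l)) + a)) + (\<Sum>l<m. (e (Suc (2*l)) + a) * (e (Suc (Suc (2*l))) - a))"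
      using r(1) by (simp add: sum_double d_def)
    also have "\<dots> = (\<Sum>l<m. e (2*l) * e (Suc (2*l))) + a * (\<Sum>l<m. e (2*l)) - a * (\<Sum>l<m. e (Suc (2*l)))
        - m * a\<^sup>2 + ((\<Sum>l<m. e (Suc (2*l)) * e (Suc (Suc (2*l)))) + a * (\<Sum>l<m. e (Suc (Suc (2*l))))
        - a * (\<Sum>l<m. e (Suc (2*l))) - m * a\<^sup>2)"
      by (simp add: algebra_simps sum.distrib sum_subtractf sum_distrib_left power2_eq_square)
    also have "\<dots> = (\<Sum>k<2*m. e k * e (Suc k)) + 2 * m * a\<^sup>2"
      by (simp add: sum_double s ev od power2_eq_square)
    finally show ?thesis .
  qed
  moreover have d2: "(\<Sum>k<2*m. (d k)\<^sup>2) =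
      t * ((\<Sum>l<m. (e (2*l))\<^sup>2) - m * a\<^sup>2) + ((\<Sum>l<m. (e (Suc (2*l)))\<^sup>2) - m * a\<^sup>2) / t"
  proof -
    have sq: "(\<Sum>l<m. (e (2*l) - a)\<^sup>2) = (\<Sum>l<m. (e (2*l))\<^sup>2) - 2 * a * (\<Sum>l<m. e (2*l)) + m * a\<^sup>2"
      "(\<Sum>l<m. (e (Suc (2*l)) + a)\<^sup>2) = (\<Sum>l<m. (e (Suc (2*l)))\<^sup>2) + 2 * a * (\<Sum>l<m. e (Suc (2*l))) + m * a\<^sup>2"
      by (simp_all add: power2_diff power2_sum sum.distrib sum_subtractf sum_distrib_left mult_ac)
    have "(\<Sum>k<2*m. (d k)\<^sup>2) = t * (\<Sum>l<m. (e (2*l) - a)\<^sup>2) + (\<Sum>l<m. (e (Suc (2*l)) + a)\<^sup>2) / t"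
      by (simp add: sum_double d_def power_mult_distrib power_divide r(2) sum_distrib_left sum_divide_distrib)
    then show ?thesis unfolding sq ev od
      by (simp add: power2_eq_square algebra_simps add_divide_distrib diff_divide_distrib)
  qed
  moreover have "2 * m * a\<^sup>2 + c * (t * (m * a\<^sup>2) + m * a\<^sup>2 / t) \<ge> 0" using c t by simp
  moreover have "c * (\<Sum>k<2*m. (d k)\<^sup>2) =
      c * (t * (\<Sum>l<m. (e (2*l))\<^sup>2) + (\<Sum>l<m. (e (Suc (2*l)))\<^sup>2) / t) - c * (t * (m * a\<^sup>2) + m * a\<^sup>2 / t)"
    unfolding d2 by (simp add: algebra_simps diff_divide_distrib)
  ultimately show ?thesis unfolding c_def by linarith
qed

section \<open>The spectral gap of the weighted Cayley graph\<close>

lemma (in group) sum_translate: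
  assumes "h \<in> carrier G"
  shows "(\<Sum>g\<in>carrier G. F (g \<otimes> h)) = (\<Sum>g\<in>carrier G. F g)"
proof (rule sum.reindex_bij_betw)
  show "bij_betw (\<lambda>g. g \<otimes> h) (carrier G) (carrier G)"
    by (rule bij_betw_byWitness[where f' = "\<lambda>g. g \<otimes> inv h"]) (use assms in \<open>auto simp: m_assoc\<close>)
qed

text \<open>The differences of \<open>f\<close> along the \<open>2m\<close>-cycle \<open>g, ga, gab, gaba, \<dots>\<close> add up to zero;
  the claim is the sum over all \<open>g\<close> of the cyclic inequality for these differences.\<close>

lemma (in group) dihedral_inequality:
  fixes f :: "'a \<Rightarrow> real" and m :: nat
  assumes fin: "finite (carrier G)"
    and ab: "a \<in> carrier G" "b \<in> carrier G" "a \<otimes> a = \<one>" "b \<otimes> b = \<one>"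
    and m: "m \<ge> 2" "(a \<otimes> b) [^] m = \<one>" and t: "t > 0"
  shows "2 * (\<Sum>g\<in>carrier G. (f g - f (g \<otimes> a)) * (f g - f (g \<otimes> b)))
    + cos (pi / m) * (t * (\<Sum>g\<in>carrier G. (f g - f (g \<otimes> a))\<^sup>2)
        + (\<Sum>g\<in>carrier G. (f g - f (g \<otimes> b))\<^sup>2) / t) \<ge> 0"
proof -
  define A where "A = (\<Sum>g\<in>carrier G. (f g - f (g \<otimes> a))\<^sup>2)"
  define B where "B = (\<Sum>g\<in>carrier G. (f g - f (g \<otimes> b))\<^sup>2)"
  define C where "C = (\<Sum>g\<in>carrier G. (f g - f (g \<otimes> a)) * (f g - f (g \<otimes> b)))"
  \<comment> \<open>The product of the first \<open>k\<close> letters of the alternating word a, b,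
    a, b, ...\<close>
  define w where "w k = (a \<otimes> b) [^] (k div 2) \<otimes> (if even k then \<one> else a)" for k :: nat
  define e where "e g k = f (g \<otimes> w (Suc k)) - f (g \<otimes> w k)" for g k
  have w_closed [simp]: "w k \<in> carrier G" for k using ab by (simp add: w_def)
  have w_even: "w (Suc (2 * l)) = w (2 * l) \<otimes> a" for l
    using ab by (simp add: w_def)
  have w_odd: "w (Suc (Suc (2 * l))) = w (Suc (2 * l)) \<otimes> b" for l
    using ab by (simp add: w_def m_assoc)
  have w_per: "w (k + 2 * m) = w k" for k
  proof -
    have "(k + 2 * m) div 2 = k div 2 + m" by simp
    then show ?thesis using ab m by (simp add: w_def nat_pow_mult[symmetric])
  qed
  have inv_a: "g \<otimes> a \<otimes> a = g" and inv_b: "g \<otimes> b \<otimes> b = g" if "g \<in> carrier G" for g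
    using that ab by (simp_all add: m_assoc)
  have cycle: "(\<Sum>k<2*m. e g k * e g (Suc k)) \<le>
      cos (pi / m) * (t * (\<Sum>l<m. (e g (2*l))\<^sup>2) + (\<Sum>l<m. (e g (Suc (2*l)))\<^sup>2) / t)" for g
  proof (rule weighted_cycle_product_sum_le[OF m(1) t])
    show "e g (k + 2 * m) = e g k" for k using w_per[of k] w_per[of "Suc k"] by (simp add: e_def)
    show "(\<Sum>k<2*m. e g k) = 0"
      using w_per[of 0] sum_lessThan_telescope[of "\<lambda>k. f (g \<otimes> w k)" "2 * m"] by (simp add: e_def)
  qed
  have ev: "(\<Sum>g\<in>carrier G. (e g (2 * l))\<^sup>2) = A" for l
  proof -
    have "(\<Sum>g\<in>carrier G. (e g (2 * l))\<^sup>2) =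
        (\<Sum>g\<in>carrier G. (f (g \<otimes> w (2 * l)) - f ((g \<otimes> w (2 * l)) \<otimes> a))\<^sup>2)"
      using ab by (intro sum.cong) (simp_all add: e_def w_even m_assoc power2_commute)
    then show ?thesis
      using sum_translate[OF w_closed, of "\<lambda>g. (f g - f (g \<otimes> a))\<^sup>2"] by (simp add: A_def)
  qed
  have od: "(\<Sum>g\<in>carrier G. (e g (Suc (2 * l)))\<^sup>2) = B" for l
  proof -
    have "(\<Sum>g\<in>carrier G. (e g (Suc (2 * l)))\<^sup>2) =
        (\<Sum>g\<in>carrier G. (f (g \<otimes> w (Suc (2 * l))) - f ((g \<otimes> w (Suc (2 * l))) \<otimes> b))\<^sup>2)"
      using ab by (intro sum.cong) (simp_all add: e_def w_odd m_assoc power2_commute)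
    then show ?thesis
      using sum_translate[OF w_closed, of "\<lambda>g. (f g - f (g \<otimes> b))\<^sup>2"] by (simp add: B_def)
  qed
  \<comment> \<open>The cycle neighbours of \<open>g \<otimes> w (Suc k)\<close> are its translates
    by \<open>a\<close> and by \<open>b\<close>, in an order depending on the parity of
    \<open>k\<close>. One consecutive difference enters the vertex and the other leaves it, hence
    the minus sign.\<close>
  have cross: "(\<Sum>g\<in>carrier G. e g k * e g (Suc k)) = - C" for k
  proof -
    have "e g k * e g (Suc k) = - ((f (g \<otimes> w (Suc k)) - f (g \<otimes> w (Suc k) \<otimes> a))
        * (f (g \<otimes> w (Suc k)) - f (g \<otimes> w (Suc k) \<otimes> b)))" if g: "g \<in> carrier G" for g
    proof (cases "even k")
      case True
      then obtain l where k: "k = 2 * l" by blast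
      have "g \<otimes> w (Suc k) \<otimes> a = g \<otimes> w k" "g \<otimes> w (Suc k) \<otimes> b = g \<otimes> w (Suc (Suc k))"
        using g ab inv_a[of "w k"] by (simp_all add: k w_even w_odd m_assoc)
      then show ?thesis by (simp add: e_def algebra_simps)
    next
      case False
      then obtain l where k: "k = Suc (2 * l)" by (metis oddE Suc_eq_plus1)
      have "w (Suc (Suc k)) = w (Suc k) \<otimes> a"
        using w_even[of "Suc l"] by (simp add: k)
      then have "g \<otimes> w (Suc k) \<otimes> a = g \<otimes> w (Suc (Suc k))" "g \<otimes> w (Suc k) \<otimes> b = g \<otimes> w k"
        using g ab inv_b[of "w k"] by (simp_all add: k w_odd m_assoc)
      then show ?thesis by (simp add: e_def algebra_simps)
    qed
    then have "(\<Sum>g\<in>carrier G. e g k * e g (Suc k)) =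
        - (\<Sum>g\<in>carrier G. (f (g \<otimes> w (Suc k)) - f (g \<otimes> w (Suc k) \<otimes> a))
        * (f (g \<otimes> w (Suc k)) - f (g \<otimes> w (Suc k) \<otimes> b)))"
      by (simp add: sum_negf)
    then show ?thesis
      using sum_translate[OF w_closed, of "\<lambda>g. (f g - f (g \<otimes> a)) * (f g - f (g \<otimes> b))"]
      by (simp add: C_def)
  qed
  have "(\<Sum>g\<in>carrier G. \<Sum>k<2*m. e g k * e g (Suc k)) \<le>
      (\<Sum>g\<in>carrier G. cos (pi / m) * (t * (\<Sum>l<m. (e g (2*l))\<^sup>2) + (\<Sum>l<m. (e g (Suc (2*l)))\<^sup>2) / t))"
    by (intro sum_mono cycle)
  also have "(\<Sum>g\<in>carrier G. \<Sum>k<2*m. e g k * e g (Suc k)) = - (2 * m * C)"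
    by (subst sum.swap) (simp add: cross)
  also have "(\<Sum>g\<in>carrier G. cos (pi / m) * (t * (\<Sum>l<m. (e g (2*l))\<^sup>2) + (\<Sum>l<m. (e g (Suc (2*l)))\<^sup>2) / t))
      = cos (pi / m) * (t * (\<Sum>g\<in>carrier G. \<Sum>l<m. (e g (2*l))\<^sup>2)
        + (\<Sum>g\<in>carrier G. \<Sum>l<m. (e g (Suc (2*l)))\<^sup>2) / t)"
    by (simp add: sum.distrib flip: sum_distrib_left sum_divide_distrib)
  also have "(\<Sum>g\<in>carrier G. \<Sum>l<m. (e g (2*l))\<^sup>2) = m * A"
    by (subst sum.swap) (simp add: ev)
  also have "(\<Sum>g\<in>carrier G. \<Sum>l<m. (e g (Suc (2*l)))\<^sup>2) = m * B"
    by (subst sum.swap) (simp add: od)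
  finally have "0 \<le> m * (2 * C + cos (pi / m) * (t * A + B / t))"
    by (simp add: algebra_simps)
  moreover have "real m > 0" using m by simp
  ultimately have "0 \<le> 2 * C + cos (pi / m) * (t * A + B / t)"
    by (simp add: zero_le_mult_iff)
  then show ?thesis by (simp add: A_def B_def C_def)
qed

section \<open>Words and relations in a finite Coxeter system\<close>

locale finite_coxeter = group G for G :: "('g, 'b) monoid_scheme" (structure) +
  fixes s :: "'n::finite \<Rightarrow> 'g" and m :: "'n \<Rightarrow> 'n \<Rightarrow> nat"
  assumes coxeter: "coxeter_system G s m" and finite_carrier: "finite (carrier G)"
begin

lemma m_diag: "m i i = 1" and m_ge_2: "i \<noteq> j \<Longrightarrow> m i j \<ge> 2"
  and m_sym: "m i j = m j i"
  using coxeter unfolding coxeter_system_def coxeter_matrix_def by (blast, blast, metis)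

lemma s_closed [simp]: "s i \<in> carrier G"
  and word_surj: "g \<in> carrier G \<Longrightarrow> \<exists>w. word_val G s w = g"
  and word_val_eq_iff: "word_val G s u = word_val G s v \<longleftrightarrow> pres_equiv (coxeter_relators m) u v"
  using coxeter unfolding coxeter_system_def presented_by_def by blast+

lemma letter_val_closed: "letter_val G s l \<in> carrier G"
  by (cases l) simp

lemma word_val_Nil [simp]: "word_val G s [] = \<one>"
  and word_val_Cons: "word_val G s (l # w) = letter_val G s l \<otimes> word_val G s w"
  by (simp_all add: word_val_def)

lemma word_val_closed [simp]: "word_val G s w \<in> carrier G"
  by (induction w) (simp_all add: word_val_Cons letter_val_closed)

lemma word_val_append: "word_val G s (u @ v) = word_val G s u \<otimes> word_val G s v"
  by (induction u) (simp_all add: word_val_Cons letter_val_closed m_assoc)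

lemma s_pow: "(s i \<otimes> s j) [^] m i j = \<one>"
proof -
  have "word_val G s (concat (replicate k [(i, True), (j, True)])) = (s i \<otimes> s j) [^] k" for k
  proof (induction k)
    case (Suc k)
    then show ?case
      using nat_pow_Suc2[of "s i \<otimes> s j" k] by (simp add: word_val_Cons m_assoc)
  qed simp
  moreover have "pres_equiv (coxeter_relators m)
      ([] @ concat (replicate (m i j) [(i, True), (j, True)]) @ []) ([] @ [])"
    by (intro pres_equiv.relator) (auto simp: coxeter_relators_def)
  ultimately show ?thesis
    using word_val_eq_iff[of "concat (replicate (m i j) [(i, True), (j, True)])" "[]"] by simp
qed

lemma s_square: "s i \<otimes> s i = \<one>"
  using s_pow[of i i] by (simp add: m_diag)

lemma s_square_right: "g \<in> carrier G \<Longrightarrow> g \<otimes> s i \<otimes> s i = g"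
  by (simp add: m_assoc s_square)

lemma letter_val_eq: "letter_val G s (i, b) = s i"
  by (simp add: inv_unique'[symmetric] s_square)

lemma carrier_induct [consumes 1, case_names one step]:
  assumes "g \<in> carrier G" "P \<one>" "\<And>g i. g \<in> carrier G \<Longrightarrow> P g \<Longrightarrow> P (g \<otimes> s i)"
  shows "P g"
proof -
  have "P (word_val G s w)" for w
  proof (induction w rule: rev_induct)
    case (snoc l w)
    obtain i b where "l = (i, b)" by fastforce
    then have "word_val G s (w @ [l]) = word_val G s w \<otimes> s i"
      by (simp add: word_val_append word_val_Cons letter_val_eq del: letter_val.simps)
    then show ?case using assms(3) snoc by simp
  qed (simp add: assms)
  then show ?thesis using word_surj assms(1) by blast
qed

section \<open>The Dirichlet form of the Cayley graph\<close>

definition inner_sum :: "('g \<Rightarrow> real) \<Rightarrow> ('g \<Rightarrow> real) \<Rightarrow> real" where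
  "inner_sum f h = (\<Sum>g\<in>carrier G. f g * h g)"

definition diff_op :: "'n \<Rightarrow> ('g \<Rightarrow> real) \<Rightarrow> 'g \<Rightarrow> real" where
  "diff_op i f g = f g - f (g \<otimes> s i)"

lemma inner_translate:
  "(\<Sum>g\<in>carrier G. f (g \<otimes> s i) * h g) = (\<Sum>g\<in>carrier G. f g * h (g \<otimes> s i))"
proof -
  have "(\<Sum>g\<in>carrier G. f (g \<otimes> s i) * h g) =
      (\<Sum>g\<in>carrier G. f (g \<otimes> s i) * h (g \<otimes> s i \<otimes> s i))"
    by (intro sum.cong) (simp_all add: s_square_right)
  then show ?thesis using sum_translate[of "s i" "\<lambda>g. f g * h (g \<otimes> s i)"] by simp
qed

text \<open>As the generator is an involution, \<open>diff_op i\<close> is twice an orthogonal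
  projection.\<close>

lemma inner_diff_op: "2 * inner_sum (diff_op i f) f = inner_sum (diff_op i f) (diff_op i f)"
proof -
  have "(\<Sum>g\<in>carrier G. (f (g \<otimes> s i))\<^sup>2) = (\<Sum>g\<in>carrier G. (f g)\<^sup>2)"
    using sum_translate[of "s i" "\<lambda>g. (f g)\<^sup>2"] by simp
  then show ?thesis
    by (simp add: inner_sum_def diff_op_def algebra_simps sum.distrib sum_subtractf
      power2_eq_square sum_distrib_left)
qed

lemma dihedral_inner_ge:
  assumes "i \<noteq> j" "t > 0"
  shows "2 * inner_sum (diff_op i f) (diff_op j f) + cos (pi / m i j) *
    (t * inner_sum (diff_op i f) (diff_op i f) + inner_sum (diff_op j f) (diff_op j f) / t) \<ge> 0"
  using dihedral_inequality[OF finite_carrier s_closed s_closed s_square s_square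
    m_ge_2[OF assms(1)] s_pow assms(2), of f]
  by (simp add: inner_sum_def diff_op_def power2_eq_square)

lemma eigenfunction_diff:
  assumes X: "X \<in> std_simplex" and f: "f \<in> cayley_eigenspace G s X \<mu>" and g: "g \<in> carrier G"
  shows "(\<Sum>i\<in>UNIV. X $ i * diff_op i f g) = (1 - \<mu>) * f g"
proof -
  have "(\<Sum>i\<in>UNIV. X $ i * f (g \<otimes> s i)) = \<mu> * f g"
    using f g by (auto simp: cayley_eigenspace_def cayley_op_def fun_eq_iff split: if_splits)
  moreover have "(\<Sum>i\<in>UNIV. X $ i * f g) = f g"
    using X by (simp add: std_simplex_def flip: sum_distrib_right)
  ultimately show ?thesis
    by (simp add: diff_op_def right_diff_distrib sum_subtractf left_diff_distrib)
qed

text \<open>Pairing the eigenvalue equation with \<open>f\<close> expresses \<open>1 - \<mu>\<close>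
  through nonnegative edge energies. This bounds all eigenvalues by 1 and later identifies the
  eigenfunctions for 1.\<close>

lemma eigenfunction_energy:
  assumes X: "X \<in> std_simplex" and f: "f \<in> cayley_eigenspace G s X \<mu>"
  shows "(\<Sum>i\<in>UNIV. X $ i * inner_sum (diff_op i f) (diff_op i f)) = 2 * (1 - \<mu>) * inner_sum f f"
proof -
  have "(\<Sum>i\<in>UNIV. X $ i * inner_sum (diff_op i f) f) =
      (\<Sum>g\<in>carrier G. (\<Sum>i\<in>UNIV. X $ i * diff_op i f g) * f g)"
    unfolding inner_sum_def sum_distrib_left sum_distrib_right
    by (subst sum.swap) (simp add: mult_ac)
  also have "\<dots> = (1 - \<mu>) * inner_sum f f"
    using eigenfunction_diff[OF X f] by (simp add: inner_sum_def sum_distrib_left mult_ac)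
  finally have "2 * (\<Sum>i\<in>UNIV. X $ i * inner_sum (diff_op i f) f) = 2 * (1 - \<mu>) * inner_sum f f"
    by simp
  then show ?thesis
    by (simp add: sum_distrib_left mult.left_commute flip: inner_diff_op)
qed

lemma inner_self_pos:
  assumes "f \<in> cayley_eigenspace G s X \<mu>" "f h \<noteq> 0"
  shows "inner_sum f f > 0"
proof -
  have h: "h \<in> carrier G" using assms by (auto simp: cayley_eigenspace_def)
  have "0 < f h * f h" using assms(2) by (simp add: zero_less_mult_iff) linarith
  also have "\<dots> \<le> inner_sum f f"
    unfolding inner_sum_def using h finite_carrier
    by (intro member_le_sum) auto
  finally show ?thesis .
qed

lemma inner_self_nonneg: "inner_sum f f \<ge> 0"
  by (simp add: inner_sum_def sum_nonneg)

lemma eigenvalue_le_1: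
  assumes X: "X \<in> std_simplex" and "\<mu> \<in> cayley_eigenvalues G s X"
  shows "\<mu> \<le> 1"
proof -
  obtain f h where f: "f \<in> cayley_eigenspace G s X \<mu>" "f h \<noteq> 0"
    using assms by (auto simp: cayley_eigenvalues_def)
  have "0 \<le> 2 * (1 - \<mu>) * inner_sum f f"
    using X by (subst eigenfunction_energy[OF X f(1), symmetric])
      (auto intro!: sum_nonneg mult_nonneg_nonneg inner_self_nonneg simp: std_simplex_def)
  then show ?thesis using inner_self_pos[OF f] by (simp add: zero_le_mult_iff)
qed

text \<open>In the square of the Laplacian \<open>1 - P\<^sub>X\<close> the mixed terms are bounded below by
  \<open>dihedral_inner_ge\<close> with \<open>t = a\<^sub>j / a\<^sub>i\<close>. The hypothesis makes the resulting
  coefficients a multiple of those of the Laplacian itself.\<close>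

lemma eigenvalue_gap:
  assumes X: "X \<in> int_simplex" and \<mu>: "\<mu> \<in> cayley_eigenvalues G s X"
    and a: "\<And>i. a i > 0"
    and eq: "\<And>i. X $ i * a i - (\<Sum>j\<in>-{i}. cos (pi / m i j) * X $ j * a j) = c / 2 * a i"
  shows "\<mu> = 1 \<or> \<mu> \<le> 1 - c"
proof -
  have X': "X \<in> std_simplex" and X_pos: "X $ i > 0" for i
    using X by (simp_all add: int_simplex_def)
  obtain f h where f: "f \<in> cayley_eigenspace G s X \<mu>" "f h \<noteq> 0"
    using \<mu> by (auto simp: cayley_eigenvalues_def)
  define C where "C i j = inner_sum (diff_op i f) (diff_op j f)" for i j
  define \<epsilon> where "\<epsilon> i j = cos (pi / m i j)" for i j
  define S where "S = inner_sum f f"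
  have "c * (1 - \<mu>) * S = c / 2 * (\<Sum>i\<in>UNIV. X $ i * C i i)"
    using eigenfunction_energy[OF X' f(1)] by (simp add: C_def S_def)
  also have "\<dots> = (\<Sum>i\<in>UNIV. X $ i * (c / 2 * a i) / a i * C i i)"
    using a by (simp add: sum_distrib_left mult_ac less_imp_neq[symmetric])
  also have "\<dots> = (\<Sum>i\<in>UNIV. (X $ i)\<^sup>2 * C i i)
      - (\<Sum>i\<in>UNIV. \<Sum>j\<in>-{i}. \<epsilon> i j * X $ i * X $ j * (a j / a i * C i i))"
  proof -
    have "X $ i * (c / 2 * a i) / a i * C i i = (X $ i)\<^sup>2 * C i i
        - (\<Sum>j\<in>-{i}. \<epsilon> i j * X $ i * X $ j * (a j / a i * C i i))" for i
    proof -
      have "X $ i * (\<Sum>j\<in>-{i}. \<epsilon> i j * X $ j * a j) / a i * C i i =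
          (\<Sum>j\<in>-{i}. \<epsilon> i j * X $ i * X $ j * (a j / a i * C i i))"
        by (simp add: sum_distrib_left sum_distrib_right sum_divide_distrib mult_ac)
      then show ?thesis
        using a[of i] unfolding eq[symmetric] \<epsilon>_def[symmetric]
        by (simp add: right_diff_distrib left_diff_distrib diff_divide_distrib power2_eq_square)
    qed
    then show ?thesis by (simp add: sum_subtractf)
  qed
  also have "\<dots> \<le> (\<Sum>i\<in>UNIV. (X $ i)\<^sup>2 * C i i) + (\<Sum>i\<in>UNIV. \<Sum>j\<in>-{i}. X $ i * X $ j * C i j)"
  proof -
    have swap: "(\<Sum>i\<in>UNIV. \<Sum>j\<in>-{i}. F i j) = (\<Sum>i\<in>UNIV. \<Sum>j\<in>-{i}. F j i)" for F :: "'n \<Rightarrow> 'n \<Rightarrow> real"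
    proof -
      have "(\<Sum>i\<in>UNIV. \<Sum>j\<in>-{i}. F i j) = (\<Sum>i\<in>UNIV. \<Sum>j\<in>UNIV. if j = i then 0 else F i j)" for F :: "'n \<Rightarrow> 'n \<Rightarrow> real"
        by (intro sum.cong HOL.refl sum.mono_neutral_cong_left) auto
      from this[of F] this[of "\<lambda>i j. F j i"] show ?thesis
        by (subst (asm) sum.swap) (simp add: eq_commute)
    qed
    \<comment> \<open>The dihedral bounds are added with the nonnegative weights
      \<open>X $ i * X $ j\<close>. Exchanging \<open>i\<close> and \<open>j\<close> identifies the
      two diagonal contributions, as \<open>m\<close> is symmetric.\<close>
    have "0 \<le> (\<Sum>i\<in>UNIV. \<Sum>j\<in>-{i}. X $ i * X $ j *
        (2 * C i j + \<epsilon> i j * (a j / a i * C i i + a i / a j * C j j)))"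
    proof (intro sum_nonneg mult_nonneg_nonneg)
      fix i j :: 'n assume "j \<in> -{i}"
      then show "0 \<le> 2 * C i j + \<epsilon> i j * (a j / a i * C i i + a i / a j * C j j)"
        using dihedral_inner_ge[of i j "a j / a i" f] a by (simp add: C_def \<epsilon>_def mult.commute)
    qed (use X_pos in \<open>auto simp: less_imp_le\<close>)
    also have "\<dots> = 2 * (\<Sum>i\<in>UNIV. \<Sum>j\<in>-{i}. X $ i * X $ j * C i j)
        + (\<Sum>i\<in>UNIV. \<Sum>j\<in>-{i}. \<epsilon> i j * X $ i * X $ j * (a j / a i * C i i))
        + (\<Sum>i\<in>UNIV. \<Sum>j\<in>-{i}. \<epsilon> i j * X $ i * X $ j * (a i / a j * C j j))"
      by (simp add: sum.distrib sum_distrib_left algebra_simps)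
    also have "(\<Sum>i\<in>UNIV. \<Sum>j\<in>-{i}. \<epsilon> i j * X $ i * X $ j * (a i / a j * C j j)) =
        (\<Sum>i\<in>UNIV. \<Sum>j\<in>-{i}. \<epsilon> i j * X $ i * X $ j * (a j / a i * C i i))"
      by (subst swap) (simp add: \<epsilon>_def m_sym mult_ac)
    finally show ?thesis by simp
  qed
  also have "\<dots> = (\<Sum>i\<in>UNIV. \<Sum>j\<in>UNIV. X $ i * X $ j * C i j)"
  proof -
    have "(\<Sum>j\<in>UNIV. X $ i * X $ j * C i j) = (X $ i)\<^sup>2 * C i i + (\<Sum>j\<in>-{i}. X $ i * X $ j * C i j)" for i
      by (subst sum.remove[of UNIV i]) (simp_all add: Compl_eq_Diff_UNIV power2_eq_square)
    then show ?thesis by (simp add: sum.distrib)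
  qed
  also have "\<dots> = (\<Sum>i\<in>UNIV. \<Sum>g\<in>carrier G. \<Sum>j\<in>UNIV. X $ i * X $ j * (diff_op i f g * diff_op j f g))"
    unfolding C_def inner_sum_def sum_distrib_left by (intro sum.cong HOL.refl sum.swap)
  also have "\<dots> = (\<Sum>g\<in>carrier G. \<Sum>i\<in>UNIV. \<Sum>j\<in>UNIV. X $ i * X $ j * (diff_op i f g * diff_op j f g))"
    by (rule sum.swap)
  also have "\<dots> = (\<Sum>g\<in>carrier G. (\<Sum>i\<in>UNIV. X $ i * diff_op i f g) * (\<Sum>j\<in>UNIV. X $ j * diff_op j f g))"
    by (simp only: sum_product) (simp add: mult_ac)
  also have "\<dots> = (1 - \<mu>)\<^sup>2 * S"
    using eigenfunction_diff[OF X' f(1)]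
    by (simp add: S_def inner_sum_def sum_distrib_left power2_eq_square mult_ac)
  \<comment> \<open>The chain amounts to
    \<open>c * (1 - \<mu>) * S \<le> (1 - \<mu>)^2 * S\<close>.\<close>
  finally have "0 \<le> S * ((1 - \<mu>) * (1 - \<mu> - c))" by (simp add: algebra_simps power2_eq_square)
  moreover have "S > 0" unfolding S_def by (rule inner_self_pos[OF f])
  moreover have "\<mu> \<le> 1" by (rule eigenvalue_le_1[OF X' \<mu>])
  ultimately show ?thesis by (auto simp: zero_le_mult_iff)
qed

end

section \<open>Eigenspaces and the ordered spectrum\<close>

interpretation fun_space: vector_space "\<lambda>(c::real) (f::'a \<Rightarrow> real) g. c * f g"
  by unfold_locales (simp_all add: fun_eq_iff algebra_simps)

lemma sum_fun_apply: "(\<Sum>i\<in>A. F i) x = (\<Sum>i\<in>A. F i x)"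
  for F :: "'i \<Rightarrow> 'a \<Rightarrow> 'b::comm_monoid_add"
  by (induction A rule: infinite_finite_induct) simp_all

text \<open>Functions on the whole type may form an infinite-dimensional space. Indicators of group
  elements confine the eigenspaces to a finite-dimensional one.\<close>

lemma finite_support_span:
  assumes "finite A" "\<And>g. g \<notin> A \<Longrightarrow> f g = 0"
  shows "f \<in> fun_space.span ((\<lambda>h g. if g = h then 1 else 0) ` A)"
proof -
  have "f = (\<Sum>h\<in>A. (\<lambda>g. f h * (if g = h then 1 else 0)))"
    using assms by (auto simp: fun_eq_iff sum_fun_apply if_distrib cong: if_cong)
  also have "\<dots> \<in> fun_space.span ((\<lambda>h g. if g = h then 1 else 0) ` A)"
    by (intro fun_space.span_sum fun_space.span_scale fun_space.span_base imageI)
  finally show ?thesis .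
qed

text \<open>Multiset difference also covers \<open>a = b\<close>, which occurs when the eigenvalue 1
  is multiple.\<close>

lemma rev_sorted_list_of_multiset_nth_1:
  fixes N :: "'a::linorder multiset"
  assumes sub: "{#a, b#} \<subseteq># N" and "b \<le> a" and max: "\<And>x. x \<in># N - {#a, b#} \<Longrightarrow> x \<le> b"
  shows "rev (sorted_list_of_multiset N) ! 1 = b"
proof -
  define N' where "N' = N - {#a, b#}"
  have "N = N' + {#a, b#}" unfolding N'_def using sub by (rule subset_mset.diff_add[symmetric])
  moreover have "sorted (sorted_list_of_multiset N' @ [b, a])"
    using max \<open>b \<le> a\<close> by (force simp: sorted_append N'_def[symmetric])
  moreover have "mset (sorted_list_of_multiset N' @ [b, a]) = N' + {#a, b#}" by simp
  ultimately have "sorted_list_of_multiset N = sorted_list_of_multiset N' @ [b, a]"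
    by (metis sorted_list_of_multiset_mset sorted_sort_id)
  then show ?thesis by simp
qed

context finite_coxeter
begin

lemma eigenspace_subset_span:
  "cayley_eigenspace G s X \<mu> \<subseteq> fun_space.span ((\<lambda>h g. if g = h then 1 else 0) ` carrier G)"
  using finite_support_span[OF finite_carrier] by (auto simp: cayley_eigenspace_def)

lemma card_le_cayley_mult:
  assumes "B \<subseteq> cayley_eigenspace G s X \<mu>" "fun_space.independent B"
  shows "card B \<le> cayley_mult G s X \<mu>"
proof -
  obtain B' where B': "B' \<subseteq> cayley_eigenspace G s X \<mu>" "fun_space.independent B'"
    "cayley_eigenspace G s X \<mu> \<subseteq> fun_space.span B'" "card B' = cayley_mult G s X \<mu>"
    unfolding cayley_mult_def by (rule fun_space.basis_exists)
  have "finite B'"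
    using fun_space.independent_span_bound[of _ B'] B' eigenspace_subset_span finite_carrier
    by (meson finite_imageI subset_trans)
  then show ?thesis
    using fun_space.independent_span_bound[of B' B] assms B' by (metis subset_trans)
qed

text \<open>An injective linear map sends the standard basis to independent eigenfunctions. It is
  later applied to the coefficient functions of the reflection representation.\<close>

lemma cayley_mult_ge_CARD:
  fixes F :: "real ^ 'k \<Rightarrow> 'g \<Rightarrow> real"
  assumes add: "\<And>v w. F (v + w) = F v + F w" and scale: "\<And>c v. F (c *\<^sub>R v) = (\<lambda>g. c * F v g)"
    and inj: "\<And>v. F v = 0 \<Longrightarrow> v = 0" and eig: "\<And>v. F v \<in> cayley_eigenspace G s X \<mu>"
  shows "CARD('k) \<le> cayley_mult G s X \<mu>"
proof -
  interpret F: Vector_Spaces.linear "(*\<^sub>R)" "\<lambda>(c::real) (f::'g \<Rightarrow> real) g. c * f g" F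
    by unfold_locales (simp_all add: add scale algebra_simps)
  have injF: "inj F" using inj F.inj_iff_eq_0 by blast
  then have "fun_space.independent (F ` Basis)"
    using F.independent_injective_image[of Basis] independent_Basis
    by (simp add: dependent_raw_def inj_on_def)
  then have "card (F ` Basis) \<le> cayley_mult G s X \<mu>"
    by (intro card_le_cayley_mult) (use eig in auto)
  moreover have "card (F ` Basis) = CARD('k)"
    using card_image[of F Basis] injF by (simp add: inj_on_def)
  ultimately show ?thesis by simp
qed

lemma cayley_op_self_adjoint:
  "inner_sum (cayley_op G s X f) h = inner_sum f (cayley_op G s X h)"
proof -
  have "inner_sum (cayley_op G s X f) h = (\<Sum>g\<in>carrier G. \<Sum>j\<in>UNIV. X $ j * (f (g \<otimes> s j) * h g))"
    by (simp add: inner_sum_def cayley_op_def sum_distrib_left mult_ac)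
  also have "\<dots> = (\<Sum>j\<in>UNIV. X $ j * (\<Sum>g\<in>carrier G. f (g \<otimes> s j) * h g))"
    unfolding sum_distrib_left by (rule sum.swap)
  also have "\<dots> = (\<Sum>j\<in>UNIV. X $ j * (\<Sum>g\<in>carrier G. f g * h (g \<otimes> s j)))"
    by (simp add: inner_translate)
  also have "\<dots> = (\<Sum>g\<in>carrier G. \<Sum>j\<in>UNIV. X $ j * (f g * h (g \<otimes> s j)))"
    unfolding sum_distrib_left by (rule sum.swap)
  also have "\<dots> = inner_sum f (cayley_op G s X h)"
    by (simp add: inner_sum_def cayley_op_def sum_distrib_left mult_ac)
  finally show ?thesis .
qed

lemma eigenspaces_orthogonal:
  assumes "f \<in> cayley_eigenspace G s X \<mu>" "h \<in> cayley_eigenspace G s X \<nu>" "\<mu> \<noteq> \<nu>"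
  shows "inner_sum f h = 0"
proof -
  have "inner_sum (\<lambda>g. \<mu> * f g) h = inner_sum f (\<lambda>g. \<nu> * h g)"
    using cayley_op_self_adjoint[of X f h] assms by (simp add: cayley_eigenspace_def)
  moreover have "inner_sum (\<lambda>g. \<mu> * f g) h = \<mu> * inner_sum f h"
    "inner_sum f (\<lambda>g. \<nu> * h g) = \<nu> * inner_sum f h"
    by (simp_all add: inner_sum_def sum_distrib_left mult_ac)
  ultimately show ?thesis using assms by simp
qed

text \<open>Eigenfunctions chosen one per eigenvalue are orthogonal, hence independent in a
  finite-dimensional space. Finiteness matters because the spectrum is defined by a sum over the
  eigenvalues, and an infinite sum would default to the empty multiset.\<close>

lemma finite_cayley_eigenvalues: "finite (cayley_eigenvalues G s X)"
proof -
  define E where "E = cayley_eigenvalues G s X"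
  have "\<forall>\<mu>\<in>E. \<exists>f. f \<in> cayley_eigenspace G s X \<mu> \<and> inner_sum f f > 0"
    unfolding E_def cayley_eigenvalues_def using inner_self_pos by blast
  then obtain F where F: "\<And>\<mu>. \<mu> \<in> E \<Longrightarrow> F \<mu> \<in> cayley_eigenspace G s X \<mu>"
    "\<And>\<mu>. \<mu> \<in> E \<Longrightarrow> inner_sum (F \<mu>) (F \<mu>) > 0" by metis
  have orth: "inner_sum (F \<mu>) (F \<nu>) = 0" if "\<mu> \<in> E" "\<nu> \<in> E" "\<mu> \<noteq> \<nu>" for \<mu> \<nu>
    using eigenspaces_orthogonal F(1) that by blast
  have inj: "inj_on F E"
  proof (rule inj_onI)
    fix \<mu> \<nu> assume *: "\<mu> \<in> E" "\<nu> \<in> E" "F \<mu> = F \<nu>"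
    then show "\<mu> = \<nu>" using orth[of \<mu> \<nu>] F(2)[of \<mu>] by force
  qed
  have scalars: "u v = 0"
    if T: "finite T" "T \<subseteq> F ` E" "(\<Sum>f\<in>T. (\<lambda>g. u f * f g)) = 0" and v: "v \<in> T" for T u v
  proof -
    obtain \<mu> where \<mu>: "\<mu> \<in> E" "v = F \<mu>" using T v by blast
    have "0 = inner_sum (\<Sum>f\<in>T. (\<lambda>g. u f * f g)) v" by (simp add: T(3) inner_sum_def)
    also have "\<dots> = (\<Sum>f\<in>T. u f * inner_sum f v)"
      unfolding inner_sum_def sum_fun_apply sum_distrib_right sum_distrib_left
      by (subst sum.swap) (simp add: mult_ac)
    also have "\<dots> = (\<Sum>f\<in>T. if f = v then u v * inner_sum v v else 0)"
    proof (intro sum.cong HOL.refl)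
      fix f assume "f \<in> T"
      then obtain \<nu> where "\<nu> \<in> E" "f = F \<nu>" using T by blast
      then show "u f * inner_sum f v = (if f = v then u v * inner_sum v v else 0)"
        using orth[of \<nu> \<mu>] \<mu> by auto
    qed
    also have "\<dots> = u v * inner_sum v v" using T v by simp
    finally show "u v = 0" using F(2)[OF \<mu>(1)] \<mu> by simp
  qed
  then have "fun_space.independent (F ` E)"
    unfolding fun_space.independent_explicit_module by blast
  moreover have "F ` E \<subseteq> fun_space.span ((\<lambda>h g. if g = h then 1 else 0) ` carrier G)"
    using F(1) eigenspace_subset_span by blast
  ultimately have "finite (F ` E)"
    using fun_space.independent_span_bound finite_carrier by blast
  then show ?thesis using inj finite_imageD E_def by blast
qed

section \<open>Counting eigenvalues in the ordered spectrum\<close>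

definition spectrum_mset :: "real ^ 'n \<Rightarrow> real multiset" where
  "spectrum_mset X = (\<Sum>\<mu>\<in>cayley_eigenvalues G s X. replicate_mset (cayley_mult G s X \<mu>) \<mu>)"

lemma count_spectrum_mset:
  "count (spectrum_mset X) \<mu> = (if \<mu> \<in> cayley_eigenvalues G s X then cayley_mult G s X \<mu> else 0)"
  using finite_cayley_eigenvalues[of X]
  by (simp add: spectrum_mset_def count_sum if_distrib cong: if_cong)

lemma cayley_mult_pos_imp_eigenvalue:
  assumes "cayley_mult G s X \<mu> > 0"
  shows "\<mu> \<in> cayley_eigenvalues G s X"
proof (rule ccontr)
  assume "\<mu> \<notin> cayley_eigenvalues G s X"
  then have "cayley_eigenspace G s X \<mu> \<subseteq> fun_space.span {}"
    by (auto simp: cayley_eigenvalues_def fun_eq_iff)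
  then have "cayley_mult G s X \<mu> \<le> card ({} :: ('g \<Rightarrow> real) set)"
    unfolding cayley_mult_def by (intro fun_space.dim_le_card) auto
  then show False using assms by simp
qed

lemma count_spectrum_mset_eq_mult: "count (spectrum_mset X) \<mu> = cayley_mult G s X \<mu>"
  using cayley_mult_pos_imp_eigenvalue[of X \<mu>] by (auto simp: count_spectrum_mset)

lemma cayley_lambda_1_eqI:
  assumes sub: "{#1, b#} \<subseteq># spectrum_mset X" and b: "b \<le> 1"
    and max: "\<And>\<mu>. \<mu> \<in># spectrum_mset X - {#1, b#} \<Longrightarrow> \<mu> \<le> b"
  shows "cayley_lambda G s 1 X = b"
  unfolding cayley_lambda_def cayley_spectrum_def spectrum_mset_def[symmetric]
  by (rule rev_sorted_list_of_multiset_nth_1[OF sub b max])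

text \<open>For positive weights, zero energy makes \<open>f\<close> invariant under every
  generator. The generators reach the whole group from the identity, so \<open>f\<close> is constant
  on it.\<close>

lemma cayley_mult_1_interior:
  assumes X: "X \<in> int_simplex"
  shows "cayley_mult G s X 1 = 1"
proof -
  have X': "X \<in> std_simplex" and X_pos: "X $ i > 0" for i
    using X by (simp_all add: int_simplex_def)
  define h where "h = (\<lambda>g. if g \<in> carrier G then 1 else (0::real))"
  have "cayley_op G s X h = (\<lambda>g. 1 * h g)"
    using X' by (auto simp: cayley_op_def h_def fun_eq_iff std_simplex_def)
  then have "{h} \<subseteq> cayley_eigenspace G s X 1" by (auto simp: cayley_eigenspace_def h_def)
  moreover have "h \<one> \<noteq> 0" by (simp add: h_def)
  then have "h \<noteq> 0" by (metis zero_fun_apply)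
  ultimately have "card {h} \<le> cayley_mult G s X 1" by (intro card_le_cayley_mult) auto
  moreover have "cayley_eigenspace G s X 1 \<subseteq> fun_space.span {h}"
  proof
    fix f assume f: "f \<in> cayley_eigenspace G s X 1"
    have "(\<Sum>i\<in>UNIV. X $ i * inner_sum (diff_op i f) (diff_op i f)) = 0"
      using eigenfunction_energy[OF X' f] by simp
    then have "inner_sum (diff_op i f) (diff_op i f) = 0" for i
      using X_pos by (subst (asm) sum_nonneg_eq_0_iff)
        (auto simp: less_imp_le inner_self_nonneg less_imp_neq[symmetric])
    then have step: "f (g \<otimes> s i) = f g" if "g \<in> carrier G" for g i
      using that finite_carrier unfolding inner_sum_def
      by (subst (asm) sum_nonneg_eq_0_iff) (auto simp: diff_op_def)
    have const: "f g = f \<one>" if "g \<in> carrier G" for g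
      using that by (induction rule: carrier_induct) (simp_all add: step)
    have "f g = f \<one> * h g" for g
      using f const[of g] by (cases "g \<in> carrier G") (simp_all add: h_def cayley_eigenspace_def)
    then have "f = (\<lambda>g. f \<one> * h g)" by (rule ext)
    moreover have "(\<lambda>g. f \<one> * h g) \<in> fun_space.span {h}"
      by (intro fun_space.span_scale fun_space.span_base) simp
    ultimately show "f \<in> fun_space.span {h}" by metis
  qed
  then have "cayley_mult G s X 1 \<le> card {h}"
    unfolding cayley_mult_def by (intro fun_space.dim_le_card) auto
  ultimately show ?thesis by simp
qed

lemma mem_spectrum_mset: "\<mu> \<in># spectrum_mset X \<Longrightarrow> \<mu> \<in> cayley_eigenvalues G s X"
  by (metis cayley_mult_pos_imp_eigenvalue count_greater_zero_iff count_spectrum_mset_eq_mult)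

lemma cayley_lambda_1_interior:
  assumes X: "X \<in> int_simplex" and c: "c > 0" and mult: "cayley_mult G s X (1 - c) > 0"
    and gap: "\<And>\<mu>. \<mu> \<in> cayley_eigenvalues G s X \<Longrightarrow> \<mu> = 1 \<or> \<mu> \<le> 1 - c"
  shows "cayley_lambda G s 1 X = 1 - c"
proof (rule cayley_lambda_1_eqI)
  have count1: "count (spectrum_mset X) 1 = 1"
    by (simp add: count_spectrum_mset_eq_mult cayley_mult_1_interior[OF X])
  show sub: "{#1, 1 - c#} \<subseteq># spectrum_mset X"
    using count1 mult c by (auto simp: subseteq_mset_def count_spectrum_mset_eq_mult)
  show "\<mu> \<le> 1 - c" if \<mu>: "\<mu> \<in># spectrum_mset X - {#1, 1 - c#}" for \<mu>
  proof -
    have "\<mu> \<noteq> 1" using \<mu> count1 c by (auto simp: in_diff_count)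
    then show ?thesis using gap mem_spectrum_mset in_diffD[OF \<mu>] by blast
  qed
qed (use c in simp)

lemma cayley_lambda_1_eq_1:
  assumes X: "X \<in> std_simplex" and mult: "cayley_mult G s X 1 \<ge> 2"
  shows "cayley_lambda G s 1 X = 1"
proof (rule cayley_lambda_1_eqI)
  show "{#1, 1#} \<subseteq># spectrum_mset X"
    using mult by (auto simp: subseteq_mset_def count_spectrum_mset_eq_mult)
  show "\<mu> \<le> 1" if "\<mu> \<in># spectrum_mset X - {#1, 1#}" for \<mu>
    using eigenvalue_le_1[OF X] mem_spectrum_mset in_diffD[OF that] by blast
qed simp

end

section \<open>Simple roots and the map \<open>\<Psi>\<^sub>\<Delta>\<close>\<close>

lemma matrix_inv_mult:
  assumes "invertible A"
  shows "A ** matrix_inv A = mat 1" "matrix_inv A ** A = mat 1"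
  using someI_ex[of "\<lambda>B. A ** B = mat 1 \<and> B ** A = mat 1"] assms
  by (simp_all add: invertible_def matrix_inv_def)

locale simple_root_system =
  fixes m :: "'n::finite \<Rightarrow> 'n \<Rightarrow> nat" and n :: "'n \<Rightarrow> real ^ 'n"
  assumes matrix: "coxeter_matrix m" and irreducible: "irreducible_coxeter m"
    and roots: "simple_roots m n"
begin

definition root_comb :: "real ^ 'n \<Rightarrow> real ^ 'n" where
  "root_comb y = (\<Sum>j\<in>UNIV. y $ j *\<^sub>R n j)"

lemma root_self [simp]: "n i \<bullet> n i = 1"
  using roots by (simp add: simple_roots_def norm_eq_1)

lemma m_diag [simp]: "m i i = 1" and m_ge_2: "i \<noteq> j \<Longrightarrow> m i j \<ge> 2"
  using matrix unfolding coxeter_matrix_def by blast+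

lemma root_inner: "i \<noteq> j \<Longrightarrow> n i \<bullet> n j = - cos (pi / m i j)"
  using roots by (simp add: simple_roots_def)

lemma pi_div_m: "i \<noteq> j \<Longrightarrow> 0 < pi / m i j" "i \<noteq> j \<Longrightarrow> pi / m i j \<le> pi / 2"
  using m_ge_2[of i j] by (auto intro!: divide_left_mono simp: field_simps)

lemma root_inner_nonpos: "i \<noteq> j \<Longrightarrow> n i \<bullet> n j \<le> 0"
  using pi_div_m[of i j] by (simp add: root_inner cos_ge_zero)

lemma root_orthogonal_imp:
  assumes "i \<noteq> j" "n i \<bullet> n j = 0"
  shows "m i j = 2"
proof -
  have eq: "cos (pi / m i j) = cos (pi / 2)" using assms root_inner[of i j] by simp
  have "pi / m i j = pi / 2"
    using pi_div_m[OF assms(1)] pi_gt_zero by (intro cos_inj_pi[OF _ _ _ _ eq]) linarith+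
  then show ?thesis using m_ge_2[OF assms(1)] by (simp add: field_simps)
qed

text \<open>Irreducibility in geometric form: otherwise the vanishing inner products would split the
  Coxeter graph.\<close>

lemma irreducible_split:
  assumes "\<And>i j. i \<in> I \<Longrightarrow> j \<notin> I \<Longrightarrow> n i \<bullet> n j = 0" "I \<noteq> {}"
  shows "I = UNIV"
proof -
  have "m i j = 2" if "i \<in> I" "j \<in> - I" for i j
    using that assms(1)[of i j] by (intro root_orthogonal_imp) auto
  then show ?thesis
    using irreducible assms(2) unfolding irreducible_coxeter_def by blast
qed

lemma root_det_pos: "root_det n > 0"
  using roots by (simp add: simple_roots_def)

lemma invertible_root_matrix: "invertible (\<chi> i. n i :: real ^ 'n ^ 'n)"
  using root_det_pos by (simp add: invertible_det_nz root_det_def)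

lemma root_matrix_mult: "((\<chi> i. n i) *v v) $ i = n i \<bullet> v"
  by (simp add: matrix_vector_mult_def inner_vec_def)

lemma root_comb_eq: "root_comb y = transpose (\<chi> i. n i) *v y"
  by (simp add: root_comb_def vec_eq_iff matrix_vector_mult_def transpose_def mult.commute)

lemma eq_0_if_orthogonal_roots:
  assumes "\<And>i. n i \<bullet> v = 0"
  shows "v = 0"
proof -
  have "(\<chi> i. n i) *v v = 0" using assms by (simp add: vec_eq_iff root_matrix_mult)
  then show ?thesis
    using invertible_root_matrix by (metis matrix_left_invertible_ker invertible_def)
qed

lemma root_comb_exists: "\<exists>y. p = root_comb y"
proof -
  have "invertible (transpose (\<chi> i. n i :: real ^ 'n ^ 'n))"
    using invertible_root_matrix by (rule transpose_invertible)
  then show ?thesis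
    unfolding root_comb_eq by (metis invertible_def matrix_vector_mul_assoc matrix_vector_mul_lid)
qed

lemma root_comb_eq_0:
  assumes "root_comb y = 0"
  shows "y = 0"
proof -
  have "invertible (transpose (\<chi> i. n i :: real ^ 'n ^ 'n))"
    using invertible_root_matrix by (rule transpose_invertible)
  then show ?thesis
    using assms unfolding root_comb_eq by (metis matrix_left_invertible_ker invertible_def)
qed

lemma linear_root_comb: "linear root_comb"
  unfolding root_comb_eq[abs_def] by (rule matrix_vector_mul_linear)

lemma root_comb_inner: "root_comb y \<bullet> v = (\<Sum>j\<in>UNIV. y $ j * (n j \<bullet> v))"
  by (simp add: root_comb_def inner_sum_left)

lemma inner_root_comb: "v \<bullet> root_comb y = (\<Sum>j\<in>UNIV. y $ j * (n j \<bullet> v))"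
  by (simp add: inner_commute[of v] root_comb_inner)

lemma root_inner_root_comb:
  "n i \<bullet> root_comb y = y $ i + (\<Sum>j\<in>-{i}. y $ j * (n i \<bullet> n j))"
proof -
  have "n i \<bullet> root_comb y = (\<Sum>j\<in>UNIV. y $ j * (n i \<bullet> n j))"
    by (simp add: inner_root_comb inner_commute)
  then show ?thesis
    by (subst (asm) sum.remove[of UNIV i]) (simp_all add: Compl_eq_Diff_UNIV)
qed

section \<open>Dual coordinates and the region \<open>F0\<close>\<close>

lemma dual_point_unique:
  "\<exists>!p. \<forall>i. n i \<bullet> p = a $ i"
proof -
  have "(\<chi> i. n i) *v (matrix_inv (\<chi> i. n i) *v a) = a"
    using invertible_root_matrix by (simp add: matrix_vector_mul_assoc matrix_inv_mult)
  then have "\<forall>i. n i \<bullet> (matrix_inv (\<chi> i. n i) *v a) = a $ i"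
    by (metis root_matrix_mult)
  moreover have "p = q" if "\<forall>i. n i \<bullet> p = a $ i" "\<forall>i. n i \<bullet> q = a $ i" for p q
    using eq_0_if_orthogonal_roots[of "p - q"] that by (simp add: inner_diff_right)
  ultimately show ?thesis by blast
qed

lemma root_inner_dual_vec: "n i \<bullet> dual_vec n j = (if i = j then root_det n else 0)"
proof -
  have "\<exists>!p. \<forall>i. n i \<bullet> p = (if i = j then root_det n else 0)"
    using dual_point_unique[of "\<chi> i. if i = j then root_det n else 0"] by simp
  from theI'[OF this] show ?thesis by (simp add: dual_vec_def)
qed

lemma root_inner_dual_comb:
  "n i \<bullet> (\<Sum>j\<in>UNIV. \<alpha> $ j *\<^sub>R dual_vec n j) = root_det n * \<alpha> $ i"
  by (simp add: inner_sum_right root_inner_dual_vec if_distrib cong: if_cong)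

lemma eq_dual_comb_iff:
  "p = (\<Sum>j\<in>UNIV. \<alpha> $ j *\<^sub>R dual_vec n j) \<longleftrightarrow> (\<forall>i. n i \<bullet> p = root_det n * \<alpha> $ i)"
proof -
  have "p = q" if "\<forall>i. n i \<bullet> p = n i \<bullet> q" for q
    using eq_0_if_orthogonal_roots[of "p - q"] that by (simp add: inner_diff_right)
  then show ?thesis by (metis root_inner_dual_comb)
qed

lemma dual_coords_nth: "dual_coords n p $ j = (n j \<bullet> p) / root_det n"
proof -
  have "p = (\<Sum>j\<in>UNIV. \<alpha> $ j *\<^sub>R dual_vec n j) \<longleftrightarrow> \<alpha> = (\<chi> j. (n j \<bullet> p) / root_det n)" for \<alpha> :: "real ^ 'n"
    unfolding eq_dual_comb_iff using root_det_pos by (auto simp: vec_eq_iff field_simps)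
  then show ?thesis by (simp add: dual_coords_def)
qed

lemma mem_F0_iff: "p \<in> F0 n \<longleftrightarrow> norm p = 1 \<and> (\<forall>j. n j \<bullet> p > 0)"
proof -
  have "(\<exists>\<alpha>::real ^ 'n. p = (\<Sum>j\<in>UNIV. \<alpha> $ j *\<^sub>R dual_vec n j) \<and> (\<forall>j. \<alpha> $ j > 0)) \<longleftrightarrow> (\<forall>j. n j \<bullet> p > 0)"
    (is "?L \<longleftrightarrow> ?R")
  proof
    assume ?L
    then show ?R using root_det_pos by (auto simp: root_inner_dual_comb)
  next
    assume ?R
    then show ?L
      unfolding eq_dual_comb_iff using root_det_pos
      by (intro exI[of _ "dual_coords n p"]) (simp add: dual_coords_nth)
  qed
  then show ?thesis by (auto simp: F0_def)
qed

lemma root_gram_mult: "(root_gram n *v y) $ i = n i \<bullet> root_comb y"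
  by (simp add: root_gram_def matrix_vector_mult_def inner_root_comb inner_commute mult.commute)

lemma invertible_root_gram: "invertible (root_gram n)"
proof -
  have "y = 0" if "root_gram n *v y = 0" for y
    using that eq_0_if_orthogonal_roots[of "root_comb y"] root_comb_eq_0[of y]
    by (metis root_gram_mult zero_index)
  then show ?thesis
    using matrix_left_invertible_ker[of "root_gram n"] invertible_left_inverse by blast
qed

text \<open>In root coordinates the inverse Gram matrix disappears: the dual coordinates are the
  Gram matrix applied to \<open>y\<close>, divided by the determinant. The diagonal inverse then
  only divides by the dual coordinates.\<close>

lemma x_prime_nth:
  assumes pos: "\<And>j. n j \<bullet> root_comb y > 0"
  shows "x_prime n (root_comb y) $ j = root_det n * (y $ j / (n j \<bullet> root_comb y))"
proof -
  define V where "V = root_det n"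
  define \<alpha> where "\<alpha> = dual_coords n (root_comb y)"
  have V: "V > 0" using root_det_pos by (simp add: V_def)
  have \<alpha>: "\<alpha> $ i = (n i \<bullet> root_comb y) / V" for i by (simp add: \<alpha>_def dual_coords_nth V_def)
  have "\<alpha> = root_gram n *v ((1 / V) *\<^sub>R y)"
    by (simp add: vec_eq_iff \<alpha> root_gram_mult linear_scale[OF linear_root_comb])
  then have gram: "matrix_inv (root_gram n) *v \<alpha> = (1 / V) *\<^sub>R y"
    using invertible_root_gram by (simp only: matrix_vector_mul_assoc matrix_inv_mult matrix_vector_mul_lid)
  have diag_mult: "(diag_mat \<alpha> *v z) $ i = \<alpha> $ i * z $ i" for z i
    by (simp add: diag_mat_def matrix_vector_mult_def if_distrib if_distribR cong: if_cong)
  have \<alpha>_pos: "\<alpha> $ i > 0" for i using pos V by (simp add: \<alpha>)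
  have "z = 0" if "diag_mat \<alpha> *v z = 0" for z
    using that \<alpha>_pos diag_mult by (metis less_irrefl mult_eq_0_iff vec_eq_iff zero_index)
  then have inv: "invertible (diag_mat \<alpha>)"
    using matrix_left_invertible_ker[of "diag_mat \<alpha>"] invertible_left_inverse by blast
  have "diag_mat \<alpha> *v (matrix_inv (diag_mat \<alpha>) *v z) = z" for z
    using inv by (simp add: matrix_vector_mul_assoc matrix_inv_mult)
  then have "\<alpha> $ j * (matrix_inv (diag_mat \<alpha>) *v z) $ j = z $ j" for z
    by (metis diag_mult)
  then have "(matrix_inv (diag_mat \<alpha>) *v z) $ j = z $ j / \<alpha> $ j" for z
    using \<alpha>_pos[of j] by (simp add: field_simps)
  then show ?thesis
    using V by (simp add: x_prime_def Let_def \<alpha>_def[symmetric] V_def[symmetric] gram) (simp add: \<alpha>)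
qed

text \<open>Splitting \<open>y\<close> into its positive and negative parts \<open>y\<^sup>+\<close> and \<open>y\<^sup>-\<close>, the combination of
  the roots with coefficients \<open>y\<^sup>-\<close> has a nonpositive square norm.\<close>

lemma root_comb_coeff_nonneg:
  assumes "\<And>j. n j \<bullet> root_comb y \<ge> 0"
  shows "y $ j \<ge> 0"
proof -
  define q where "q = (\<chi> j. max 0 (- y $ j))"
  define r where "r = (\<chi> j. max 0 (y $ j))"
  have "y = r - q" by (auto simp: vec_eq_iff q_def r_def max_def)
  then have y: "root_comb y = root_comb r - root_comb q" by (simp add: linear_diff[OF linear_root_comb])
  have "0 \<le> root_comb q \<bullet> root_comb y"
    unfolding root_comb_inner using assms by (intro sum_nonneg mult_nonneg_nonneg) (simp_all add: q_def)
  moreover have "root_comb q \<bullet> root_comb r \<le> 0"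
    unfolding root_comb_inner[of q] unfolding inner_root_comb sum_distrib_left
  proof (intro sum_nonpos)
    fix i j
    have "q $ i * r $ j \<ge> 0" by (simp add: q_def r_def)
    \<comment> \<open>The two parts have disjoint supports, so only off-diagonal Gram entries, which
      are nonpositive, contribute.\<close>
    moreover have "q $ i * r $ i = 0" by (simp add: q_def r_def max_def)
    ultimately show "q $ i * (r $ j * (n j \<bullet> n i)) \<le> 0"
      using root_inner_nonpos[of j i] by (cases "i = j") (auto simp: mult.assoc[symmetric] mult_nonneg_nonpos)
  qed
  ultimately have "root_comb q \<bullet> root_comb q \<le> 0" by (simp add: y inner_diff_right)
  then have "root_comb q \<bullet> root_comb q = 0" using inner_ge_zero[of "root_comb q"] by linarith
  then have "q = 0" by (simp add: root_comb_eq_0)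
  then have "q $ j = 0" by simp
  then show ?thesis by (simp add: q_def max_def split: if_splits)
qed

lemma root_comb_coeff_ge:
  assumes "\<And>j. y $ j \<ge> 0"
  shows "n j \<bullet> root_comb y \<le> y $ j"
proof -
  have "(\<Sum>i\<in>-{j}. y $ i * (n j \<bullet> n i)) \<le> 0"
    using assms root_inner_nonpos by (intro sum_nonpos mult_nonneg_nonpos) auto
  then show ?thesis by (simp add: root_inner_root_comb)
qed

lemma root_comb_coeff_pos:
  assumes "\<And>j. n j \<bullet> root_comb y > 0"
  shows "y $ j > 0"
  using root_comb_coeff_ge[of y j] root_comb_coeff_nonneg[of y] assms
  by (meson less_imp_le less_le_trans)

text \<open>The irreducibility step of Perron-Frobenius. At a zero coefficient the inner product is
  a sum of nonpositive terms; if it vanishes, that root is orthogonal to every root with a positive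
  coefficient, so the set of zeros is everything.\<close>

lemma nonneg_comb_eq_0:
  assumes nonneg: "\<And>j. y $ j \<ge> 0" and zero: "\<And>j. y $ j = 0 \<Longrightarrow> n j \<bullet> root_comb y = 0"
    and ex: "\<exists>j. y $ j = 0"
  shows "y = 0"
proof -
  have "{j. y $ j = 0} = UNIV"
  proof (rule irreducible_split)
    fix i j assume *: "i \<in> {j. y $ j = 0}" "j \<notin> {j. y $ j = 0}"
    have "(\<Sum>l\<in>-{i}. - (y $ l * (n i \<bullet> n l))) = 0"
      using zero[of i] * by (simp add: root_inner_root_comb sum_negf)
    then have "- (y $ j * (n i \<bullet> n j)) = 0"
      using * nonneg root_inner_nonpos by (subst (asm) sum_nonneg_eq_0_iff) (auto simp: mult_nonneg_nonpos)
    then show "n i \<bullet> n j = 0" using * by simp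
  qed (use ex in simp)
  then show ?thesis by (auto simp: vec_eq_iff)
qed

section \<open>The two maps in root coordinates\<close>

lemma sum_x_prime:
  assumes pos: "\<And>j. n j \<bullet> root_comb y > 0"
  shows "(\<Sum>j\<in>UNIV. x_prime n (root_comb y) $ j) =
    root_det n * (\<Sum>i\<in>UNIV. y $ i / (n i \<bullet> root_comb y))"
  by (simp only: x_prime_nth[OF pos] sum_distrib_left)

definition coeff_ratio_sum :: "real ^ 'n \<Rightarrow> real" where
  "coeff_ratio_sum y = (\<Sum>i\<in>UNIV. y $ i / (n i \<bullet> root_comb y))"

lemma coeff_ratio_sum_pos:
  assumes pos: "\<And>j. n j \<bullet> root_comb y > 0"
  shows "coeff_ratio_sum y > 0"
  unfolding coeff_ratio_sum_def using root_comb_coeff_pos[OF pos] pos by (intro sum_pos) simp_all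

lemma Psi_Delta_nth:
  assumes pos: "\<And>j. n j \<bullet> root_comb y > 0"
  shows "Psi_Delta n (root_comb y) $ j = y $ j / (n j \<bullet> root_comb y) / coeff_ratio_sum y"
  unfolding Psi_Delta_def sum_x_prime[OF pos] coeff_ratio_sum_def[symmetric]
  using root_det_pos by (simp add: x_prime_nth[OF pos])

lemma Psi_lambda_eq:
  assumes pos: "\<And>j. n j \<bullet> root_comb y > 0"
  shows "Psi_lambda n (root_comb y) = 1 - 2 / coeff_ratio_sum y"
  unfolding Psi_lambda_def lambda_prime_def sum_x_prime[OF pos] coeff_ratio_sum_def[symmetric]
  using coeff_ratio_sum_pos[OF pos] root_det_pos by (simp add: diff_divide_distrib)

text \<open>With the coefficients \<open>y\<close> of \<open>p\<close> with respect to the simple roots, the equation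
  \<open>X = \<Psi>\<^sub>\<Delta> p\<close> becomes \<open>x\<^sub>j \<langle>n\<^sub>j, p\<rangle> = \<kappa> y\<^sub>j\<close>, where \<open>\<kappa> = (1 - \<lambda>) / 2\<close> is the inverse of
  \<open>coeff_ratio_sum y\<close>.\<close>

lemma Psi_Delta_mult:
  assumes pos: "\<And>j. n j \<bullet> root_comb y > 0"
  shows "Psi_Delta n (root_comb y) $ j * (n j \<bullet> root_comb y) = 1 / coeff_ratio_sum y * y $ j"
  using pos[of j] by (simp add: Psi_Delta_nth[OF pos])

lemma Psi_Delta_mem_simplex:
  assumes pos: "\<And>j. n j \<bullet> root_comb y > 0"
  shows "Psi_Delta n (root_comb y) \<in> int_simplex"
proof -
  have "Psi_Delta n (root_comb y) $ j > 0" for j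
    using coeff_ratio_sum_pos[OF pos] root_comb_coeff_pos[OF pos] pos by (simp add: Psi_Delta_nth[OF pos])
  moreover have "(\<Sum>j\<in>UNIV. Psi_Delta n (root_comb y) $ j) = 1"
    unfolding Psi_Delta_nth[OF pos] sum_divide_distrib[symmetric] coeff_ratio_sum_def[symmetric]
    using coeff_ratio_sum_pos[OF pos] by simp
  ultimately show ?thesis by (simp add: int_simplex_def std_simplex_def less_imp_le)
qed

lemma F0_obtain:
  assumes "p \<in> F0 n"
  obtains y where "p = root_comb y" "\<And>j. n j \<bullet> root_comb y > 0"
proof -
  obtain y where y: "p = root_comb y" using root_comb_exists by blast
  have "n j \<bullet> root_comb y > 0" for j using assms by (simp add: mem_F0_iff y)
  then show thesis by (rule that[OF y])
qed

lemma Psi_Delta_mem: "p \<in> F0 n \<Longrightarrow> Psi_Delta n p \<in> int_simplex"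
  by (erule F0_obtain) (simp add: Psi_Delta_mem_simplex)

text \<open>From rank 2 on, every simple root has a non-orthogonal neighbour, so each ratio in
  \<open>coeff_ratio_sum\<close> exceeds 1 and the sum exceeds 2. In rank 1 the only ratio is 1, and
  the value would be -1.\<close>

lemma Psi_lambda_mem:
  assumes p: "p \<in> F0 n" and rank: "CARD('n) \<ge> 2"
  shows "Psi_lambda n p \<in> {0<..<1}"
proof -
  obtain y where y: "p = root_comb y" and pos: "\<And>j. n j \<bullet> root_comb y > 0"
    by (rule F0_obtain[OF p]) (rule that)
  have "1 < y $ j / (n j \<bullet> root_comb y)" for j
  proof -
    have "{j} \<noteq> (UNIV :: 'n set)"
    proof
      assume "{j} = (UNIV :: 'n set)"
      then have "CARD('n) = card {j}" by simp
      then show False using rank by simp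
    qed
    then obtain l where l: "l \<noteq> j" "n j \<bullet> n l \<noteq> 0"
      using irreducible_split[of "{j}"] by blast
    have "n j \<bullet> n l < 0" using l root_inner_nonpos[of j l] by simp
    then have "0 < (\<Sum>i\<in>-{j}. - (y $ i * (n j \<bullet> n i)))"
      using l root_comb_coeff_pos[OF pos] root_inner_nonpos[of j]
      by (intro sum_pos2[of _ l]) (auto simp: mult_pos_neg mult_nonneg_nonpos less_imp_le)
    then have "n j \<bullet> root_comb y < y $ j" by (simp add: root_inner_root_comb sum_negf)
    then show ?thesis using pos by simp
  qed
  then have "(\<Sum>j\<in>(UNIV :: 'n set). 1) < coeff_ratio_sum y"
    unfolding coeff_ratio_sum_def by (intro sum_strict_mono) auto
  then have "2 < coeff_ratio_sum y" using rank by simp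
  then show ?thesis by (simp add: y Psi_lambda_eq[OF pos])
qed

lemma Psi_Delta_inj: "inj_on (Psi_Delta n) (F0 n)"
proof (rule inj_onI)
  fix p p' assume p: "p \<in> F0 n" and p': "p' \<in> F0 n" and eq: "Psi_Delta n p = Psi_Delta n p'"
  define X where "X = Psi_Delta n p"
  obtain y where y: "p = root_comb y" and y_inner: "\<And>j. n j \<bullet> root_comb y > 0"
    by (rule F0_obtain[OF p]) (rule that)
  obtain y' where y': "p' = root_comb y'" and y'_inner: "\<And>j. n j \<bullet> root_comb y' > 0"
    by (rule F0_obtain[OF p']) (rule that)
  define \<kappa> where "\<kappa> = 1 / coeff_ratio_sum y"
  define \<kappa>' where "\<kappa>' = 1 / coeff_ratio_sum y'"
  have X_pos: "X $ j > 0" for j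
    using Psi_Delta_mem[OF p] by (simp add: X_def int_simplex_def)
  have y_pos: "y $ j > 0" and y'_pos: "y' $ j > 0" for j
    using root_comb_coeff_pos[OF y_inner] root_comb_coeff_pos[OF y'_inner] by simp_all
  have y_eq: "X $ j * (n j \<bullet> p) = \<kappa> * y $ j" for j
    using Psi_Delta_mult[OF y_inner] by (simp add: X_def y \<kappa>_def)
  have y'_eq: "X $ j * (n j \<bullet> p') = \<kappa>' * y' $ j" for j
    using Psi_Delta_mult[OF y'_inner] by (simp add: X_def eq y' \<kappa>'_def)
  \<comment> \<open>Computing the inner product from either side gives the same positive sum, once
    with factor \<open>\<kappa>'\<close> and once with \<open>\<kappa>\<close>.\<close>
  have "p \<bullet> p' = \<kappa>' * (\<Sum>j\<in>UNIV. y $ j * y' $ j / X $ j)"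
  proof -
    have "n j \<bullet> p' = \<kappa>' * y' $ j / X $ j" for j
      using y'_eq[of j] X_pos[of j] by (simp add: field_simps)
    then show ?thesis by (simp add: y root_comb_inner sum_distrib_left mult_ac)
  qed
  moreover have "p' \<bullet> p = \<kappa> * (\<Sum>j\<in>UNIV. y $ j * y' $ j / X $ j)"
  proof -
    have "n j \<bullet> p = \<kappa> * y $ j / X $ j" for j
      using y_eq[of j] X_pos[of j] by (simp add: field_simps)
    then show ?thesis by (simp add: y' root_comb_inner sum_distrib_left mult_ac)
  qed
  moreover have "(\<Sum>j\<in>UNIV. y $ j * y' $ j / X $ j) > 0"
    using y_pos y'_pos X_pos by (intro sum_pos) simp_all
  ultimately have \<kappa>: "\<kappa>' = \<kappa>" by (simp add: inner_commute)
  \<comment> \<open>The largest multiple of \<open>y'\<close> that can be subtracted from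
    \<open>y\<close> without a negative coefficient. The difference satisfies the same eigenvalue
    equation and has a zero coefficient at \<open>l\<close>, so it vanishes.\<close>
  define r where "r = Min (range (\<lambda>j. y $ j / y' $ j))"
  have "r \<in> range (\<lambda>j. y $ j / y' $ j)" unfolding r_def by (intro Min_in) auto
  then obtain l where l: "r = y $ l / y' $ l" by blast
  define w where "w = y - r *\<^sub>R y'"
  have w: "root_comb w = p - r *\<^sub>R p'"
    by (simp add: w_def y y' linear_diff[OF linear_root_comb] linear_scale[OF linear_root_comb])
  have "w = 0"
  proof (rule nonneg_comb_eq_0)
    fix j
    have "r \<le> y $ j / y' $ j" unfolding r_def by (intro Min_le) auto
    then show "w $ j \<ge> 0" using y'_pos by (simp add: w_def field_simps)
    have "X $ j * (n j \<bullet> root_comb w) = \<kappa> * w $ j"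
      using y_eq[of j] y'_eq[of j] unfolding w by (simp add: w_def \<kappa> inner_diff_right algebra_simps)
    then show "n j \<bullet> root_comb w = 0" if "w $ j = 0" using that X_pos[of j] by simp
  next
    show "\<exists>j. w $ j = 0" using y'_pos[of l] by (intro exI[of _ l]) (simp add: w_def l)
  qed
  then have *: "p = r *\<^sub>R p'" using w linear_0[OF linear_root_comb] by simp
  have "r > 0" using y_pos y'_pos l by simp
  then have "norm p = r * norm p'" by (subst *) simp
  moreover have "norm p = 1" "norm p' = 1" using p p' by (simp_all add: mem_F0_iff)
  ultimately have "r = 1" by simp
  then show "p = p'" by (subst *) simp
qed

text \<open>The point \<open>p\<close> is obtained from the lowest eigenvector of the Gram matrix rescaled by \<open>\<surd>X\<close>.
  Passing to absolute values does not increase the quadratic form, as the off-diagonal entries are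
  nonpositive.\<close>

lemma Psi_Delta_surj:
  assumes X: "X \<in> int_simplex"
  shows "\<exists>p\<in>F0 n. Psi_Delta n p = X"
proof -
  have X_sum: "(\<Sum>j\<in>UNIV. X $ j) = 1" and X_pos: "X $ j > 0" for j
    using X by (simp_all add: int_simplex_def std_simplex_def)
  \<comment> \<open>The squared norm of \<open>L u\<close> is the quadratic form of the symmetric
    matrix with entries \<open>sqrt (X $ i * X $ j) * (n i \<bullet> n j)\<close>.\<close>
  define D where "D u = (\<chi> j. sqrt (X $ j) * u $ j)" for u :: "real ^ 'n"
  define L where "L u = root_comb (D u)" for u
  have lin_D: "linear D" by (intro linearI) (simp_all add: D_def vec_eq_iff algebra_simps)
  have lin: "linear L"
    unfolding L_def[abs_def] using linear_compose[OF lin_D linear_root_comb] by (simp add: o_def)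
  have L0: "u = 0" if "L u = 0" for u
  proof -
    have "D u = 0" using that root_comb_eq_0 by (simp add: L_def)
    then have "sqrt (X $ j) * u $ j = 0" for j by (metis D_def vec_lambda_beta zero_index)
    then show ?thesis using X_pos by (simp add: vec_eq_iff less_imp_neq[symmetric])
  qed
  have "\<exists>u\<in>sphere 0 1. \<forall>v\<in>sphere 0 1. norm (L u) \<le> norm (L v)"
    by (intro continuous_attains_inf continuous_intros linear_continuous_on)
      (auto simp: linear_conv_bounded_linear[symmetric] lin)
  then obtain u where u: "norm u = 1" and u_min: "\<And>v. norm v = 1 \<Longrightarrow> norm (L u) \<le> norm (L v)"
    by auto
  define \<kappa> where "\<kappa> = (norm (L u))\<^sup>2"
  have min: "\<kappa> * (norm v)\<^sup>2 \<le> (norm (L v))\<^sup>2" for v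
  proof (cases "v = 0")
    case False
    then have "norm (L u) \<le> norm (L ((1 / norm v) *\<^sub>R v))" by (intro u_min) simp
    also have "\<dots> = norm (L v) / norm v" using linear_scale[OF lin] by simp
    finally have "norm (L u) * norm v \<le> norm (L v)" using False by (simp add: field_simps)
    then have "(norm (L u) * norm v)\<^sup>2 \<le> (norm (L v))\<^sup>2" by (intro power_mono) simp_all
    then show ?thesis by (simp add: \<kappa>_def power_mult_distrib)
  qed (simp add: linear_0[OF lin])
  define z where "z = (\<chi> j. \<bar>u $ j\<bar>)"
  have z_norm: "norm z = 1" using u by (simp add: z_def norm_vec_def)
  have sq: "(norm (L v))\<^sup>2 = (\<Sum>i\<in>UNIV. \<Sum>j\<in>UNIV. D v $ i * D v $ j * (n i \<bullet> n j))" for v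
    by (simp add: power2_norm_eq_inner L_def root_comb_inner inner_root_comb sum_distrib_left inner_commute mult_ac)
  have z_min: "(norm (L z))\<^sup>2 \<le> \<kappa>"
    unfolding \<kappa>_def sq
  proof (intro sum_mono)
    fix i j
    have "D u $ i * D u $ j \<le> \<bar>D u $ i * D u $ j\<bar>" by simp
    also have "\<dots> = D z $ i * D z $ j"
      using X_pos by (simp add: D_def z_def abs_mult less_imp_le)
    finally have "D u $ i * D u $ j \<le> D z $ i * D z $ j" .
    moreover have "D u $ i * D u $ i = D z $ i * D z $ i" by (simp add: D_def z_def)
    ultimately show "D z $ i * D z $ j * (n i \<bullet> n j) \<le> D u $ i * D u $ j * (n i \<bullet> n j)"
      using root_inner_nonpos[of i j] by (cases "i = j") (auto intro: mult_right_mono_neg)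
  qed
  \<comment> \<open>The form \<open>(norm (L v))^2 - \<kappa> * (norm v)^2\<close> is nonnegative
    and vanishes at \<open>z\<close>, so its first variation there is zero.\<close>
  have stationary: "L z \<bullet> L v = \<kappa> * (z \<bullet> v)" for v
  proof -
    define b where "b = L z \<bullet> L v - \<kappa> * (z \<bullet> v)"
    define q where "q = (norm (L v))\<^sup>2 - \<kappa> * (norm v)\<^sup>2"
    have quad: "0 \<le> 2 * t * b + t\<^sup>2 * q" for t
    proof -
      have "(norm (L (z + t *\<^sub>R v)))\<^sup>2 = (norm (L z))\<^sup>2 + 2 * t * (L z \<bullet> L v) + t\<^sup>2 * (norm (L v))\<^sup>2"
        unfolding linear_add[OF lin] linear_scale[OF lin] power2_norm_eq_inner
        by (simp add: algebra_simps inner_commute power2_eq_square)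
      moreover have "(norm (z + t *\<^sub>R v))\<^sup>2 = 1 + 2 * t * (z \<bullet> v) + t\<^sup>2 * (norm v)\<^sup>2"
        using z_norm unfolding power2_norm_eq_inner norm_eq_1
        by (simp add: algebra_simps inner_commute power2_eq_square)
      ultimately show ?thesis
        using min[of "z + t *\<^sub>R v"] z_min by (simp add: b_def q_def algebra_simps)
    qed
    have "q \<ge> 0" using min[of v] by (simp add: q_def)
    have "b = 0"
    proof (rule ccontr)
      assume "b \<noteq> 0"
      \<comment> \<open>The parameter \<open>- (b * r)\<close> makes the linear term dominate; the
        shift by 1 keeps \<open>r\<close> defined when \<open>q = 0\<close>.\<close>
      define r where "r = 1 / (q + 1)"
      have r: "r > 0" "q * r < 1" using \<open>q \<ge> 0\<close> by (simp_all add: r_def field_simps)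
      have "0 \<le> 2 * (- (b * r)) * b + (- (b * r))\<^sup>2 * q" by (rule quad)
      also have "\<dots> = - (b\<^sup>2 * r) * (2 - q * r)"
        by (simp add: algebra_simps power2_eq_square)
      also have "\<dots> < 0"
        using r \<open>b \<noteq> 0\<close> by (intro mult_neg_pos) simp_all
      finally show False by simp
    qed
    then show ?thesis by (simp add: b_def)
  qed
  define y where "y = D z"
  have y: "X $ j * (n j \<bullet> root_comb y) = \<kappa> * y $ j" for j
  proof -
    have "D (axis j 1) = sqrt (X $ j) *\<^sub>R axis j 1" by (simp add: D_def vec_eq_iff axis_def)
    then have "L (axis j 1) = sqrt (X $ j) *\<^sub>R n j"
      by (simp add: L_def linear_scale[OF linear_root_comb])
        (simp add: root_comb_def axis_def if_distrib if_distribR cong: if_cong)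
    then have "sqrt (X $ j) * (n j \<bullet> root_comb y) = \<kappa> * z $ j"
      using stationary[of "axis j 1"] by (simp add: L_def y_def inner_axis inner_commute)
    then have "sqrt (X $ j) * (sqrt (X $ j) * (n j \<bullet> root_comb y)) = \<kappa> * (sqrt (X $ j) * z $ j)" by simp
    then show ?thesis using X_pos[of j] by (simp add: y_def D_def mult.assoc[symmetric])
  qed
  have "z \<noteq> 0" using z_norm by auto
  then have Lz: "L z \<noteq> 0" using L0 by blast
  have "\<kappa> > 0"
    using min[of z] z_min Lz z_norm by (metis mult.right_neutral norm_eq_zero one_power2 order_antisym zero_less_power2)
  have y_nonneg: "y $ j \<ge> 0" for j using X_pos by (simp add: y_def D_def z_def less_imp_le)
  have "y $ j \<noteq> 0" for j
  proof
    assume "y $ j = 0"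
    moreover have "n j \<bullet> root_comb y = 0" if "y $ j = 0" for j using y[of j] X_pos[of j] that by simp
    ultimately have "y = 0" using y_nonneg by (intro nonneg_comb_eq_0) blast+
    then show False using Lz linear_0[OF linear_root_comb] by (simp add: L_def y_def)
  qed
  then have y_pos: "y $ j > 0" for j using y_nonneg by (simp add: less_le)
  have a_pos: "n j \<bullet> root_comb y > 0" for j
    using y[of j] y_pos[of j] X_pos[of j] \<open>\<kappa> > 0\<close> by (metis mult_pos_pos zero_less_mult_pos)
  define r where "r = norm (root_comb y)"
  have r: "r > 0" using Lz by (simp add: r_def L_def y_def)
  define p where "p = root_comb ((1 / r) *\<^sub>R y)"
  have p: "p = (1 / r) *\<^sub>R root_comb y" by (simp add: p_def linear_scale[OF linear_root_comb])
  have p_pos: "n j \<bullet> p > 0" for j using a_pos r by (simp add: p)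
  have "p \<in> F0 n" using p_pos r by (simp add: mem_F0_iff p) (simp add: r_def)
  moreover have "Psi_Delta n p = X"
  proof -
    have quot: "((1 / r) *\<^sub>R y) $ j / (n j \<bullet> p) = X $ j / \<kappa>" for j
      using y[of j] a_pos[of j] r \<open>\<kappa> > 0\<close> by (simp add: p field_simps)
    have "Psi_Delta n p $ j = X $ j / \<kappa> / (\<Sum>i\<in>UNIV. X $ i / \<kappa>)" for j
      using Psi_Delta_nth[OF p_pos[unfolded p_def], of j]
      unfolding coeff_ratio_sum_def quot[unfolded p_def] by (simp only: p_def)
    then show ?thesis
      using \<open>\<kappa> > 0\<close> by (simp add: vec_eq_iff X_sum flip: sum_divide_distrib)
  qed
  ultimately show ?thesis by blast
qed

lemma bij_betw_Psi_Delta: "bij_betw (Psi_Delta n) (F0 n) int_simplex"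
  using Psi_Delta_inj Psi_Delta_mem Psi_Delta_surj by (auto simp: bij_betw_def)

end

section \<open>The reflection representation\<close>

context simple_root_system
begin

definition reflect :: "'n \<Rightarrow> real ^ 'n \<Rightarrow> real ^ 'n" where
  "reflect i v = v - (2 * (n i \<bullet> v)) *\<^sub>R n i"

lemma linear_reflect: "linear (reflect i)"
  by (intro linearI) (simp_all add: reflect_def algebra_simps)

lemma reflect_reflect [simp]: "reflect i (reflect i v) = v"
  by (simp add: reflect_def inner_diff_right algebra_simps)

lemma inner_reflect: "n i \<bullet> reflect j v = n i \<bullet> v - 2 * (n j \<bullet> v) * (n i \<bullet> n j)"
  by (simp add: reflect_def inner_diff_right)

text \<open>The composite of two reflections rotates the plane of the two roots by
  \<open>2 * \<theta>\<close>. Both inner products are needed together for the induction, which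
  rests on the three-term recurrence of the sine.\<close>

lemma reflect_comp_funpow_inner:
  assumes "\<theta> = pi / m i j" "i \<noteq> j"
  shows "sin \<theta> * (n j \<bullet> ((\<lambda>v. reflect i (reflect j v)) ^^ k) v) =
      (n j \<bullet> v) * sin (2 * k * \<theta> + \<theta>) + (n i \<bullet> v) * sin (2 * k * \<theta>)"
    and "sin \<theta> * (n i \<bullet> ((\<lambda>v. reflect i (reflect j v)) ^^ k) v) =
      - (n j \<bullet> v) * sin (2 * k * \<theta>) - (n i \<bullet> v) * sin (2 * k * \<theta> - \<theta>)"
proof (induction k)
  case (Suc k)
  define T where "T = (\<lambda>v. reflect i (reflect j v))"
  define a where "a = n i \<bullet> (T ^^ k) v"
  define b where "b = n j \<bullet> (T ^^ k) v"
  define c where "c = cos \<theta>"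
  define \<phi> where "\<phi> = 2 * real k * \<theta>"
  define A where "A = n i \<bullet> v"
  define B where "B = n j \<bullet> v"
  have ij: "n i \<bullet> n j = - c" "n j \<bullet> n i = - c"
    using root_inner[OF assms(2)] by (simp_all add: c_def assms(1) inner_commute)
  have step: "(T ^^ Suc k) v = reflect i (reflect j ((T ^^ k) v))" by (simp add: T_def)
  have i: "n i \<bullet> (T ^^ Suc k) v = - a - 2 * c * b"
    unfolding step by (simp add: inner_reflect ij a_def b_def)
  have j: "n j \<bullet> (T ^^ Suc k) v = - b + 2 * c * (a + 2 * c * b)"
    unfolding step by (simp add: inner_reflect ij a_def b_def algebra_simps)
  have IH: "sin \<theta> * b = B * sin (\<phi> + \<theta>) + A * sin \<phi>"
    "sin \<theta> * a = - B * sin \<phi> - A * sin (\<phi> - \<theta>)"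
    using Suc by (simp_all add: a_def b_def T_def \<phi>_def A_def B_def)
  have rec: "sin (x + \<theta>) + sin (x - \<theta>) = 2 * c * sin x" for x
    by (simp add: sin_add sin_diff c_def)
  have r: "2 * c * sin (\<phi> - \<theta>) = sin \<phi> + sin (\<phi> - 2 * \<theta>)"
    "2 * c * sin \<phi> = sin (\<phi> + \<theta>) + sin (\<phi> - \<theta>)"
    "2 * c * sin (\<phi> + \<theta>) = sin (\<phi> + 2 * \<theta>) + sin \<phi>"
    "2 * c * sin (\<phi> + 2 * \<theta>) = sin (\<phi> + 3 * \<theta>) + sin (\<phi> + \<theta>)"
    using rec[of "\<phi> - \<theta>"] rec[of \<phi>] rec[of "\<phi> + \<theta>"] rec[of "\<phi> + 2 * \<theta>"]
    by (simp_all add: algebra_simps)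
  have "sin \<theta> * (a + 2 * c * b) = sin \<theta> * a + 2 * c * (sin \<theta> * b)"
    by (simp add: algebra_simps)
  also have "\<dots> = - B * sin \<phi> - A * sin (\<phi> - \<theta>) + B * (2 * c * sin (\<phi> + \<theta>)) + A * (2 * c * sin \<phi>)"
    unfolding IH by (simp add: algebra_simps)
  also have "\<dots> = B * sin (\<phi> + 2 * \<theta>) + A * sin (\<phi> + \<theta>)"
    unfolding r by (simp add: algebra_simps)
  finally have ab: "sin \<theta> * (a + 2 * c * b) = B * sin (\<phi> + 2 * \<theta>) + A * sin (\<phi> + \<theta>)" .
  have "sin \<theta> * (- b + 2 * c * (a + 2 * c * b)) =
      - (sin \<theta> * b) + 2 * c * (sin \<theta> * (a + 2 * c * b))" by (simp add: algebra_simps)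
  also have "\<dots> = - (B * sin (\<phi> + \<theta>) + A * sin \<phi>)
      + B * (2 * c * sin (\<phi> + 2 * \<theta>)) + A * (2 * c * sin (\<phi> + \<theta>))"
    unfolding IH ab by (simp add: algebra_simps)
  also have "\<dots> = B * sin (\<phi> + 3 * \<theta>) + A * sin (\<phi> + 2 * \<theta>)"
    unfolding r by (simp add: algebra_simps)
  finally have ba: "sin \<theta> * (- b + 2 * c * (a + 2 * c * b)) = B * sin (\<phi> + 3 * \<theta>) + A * sin (\<phi> + 2 * \<theta>)" .
  have angle: "2 * real (Suc k) * \<theta> = \<phi> + 2 * \<theta>" by (simp add: \<phi>_def algebra_simps)
  have angles: "\<phi> + 2 * \<theta> + \<theta> = \<phi> + 3 * \<theta>" "\<phi> + 2 * \<theta> - \<theta> = \<phi> + \<theta>" by simp_all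
  {
    case 1
    show ?case unfolding angle angles T_def[symmetric] j A_def[symmetric] B_def[symmetric] by (rule ba)
  next
    case 2
    have "sin \<theta> * (- a - 2 * c * b) = - (sin \<theta> * (a + 2 * c * b))" by (simp add: algebra_simps)
    then show ?case unfolding angle angles T_def[symmetric] i A_def[symmetric] B_def[symmetric] ab by simp
  }
qed (simp_all)

lemma reflect_comp_funpow_span:
  "\<exists>a b. ((\<lambda>v. reflect i (reflect j v)) ^^ k) v - v = a *\<^sub>R n i + b *\<^sub>R n j"
proof (induction k)
  case (Suc k)
  define w where "w = ((\<lambda>v. reflect i (reflect j v)) ^^ k) v"
  obtain a b where "w - v = a *\<^sub>R n i + b *\<^sub>R n j" using Suc w_def by blast
  moreover obtain c d where "reflect i (reflect j w) = w - c *\<^sub>R n j - d *\<^sub>R n i"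
    unfolding reflect_def by blast
  ultimately have "reflect i (reflect j w) - v = (a - d) *\<^sub>R n i + (b - c) *\<^sub>R n j"
    by (simp add: algebra_simps)
  then show ?case by (auto simp: w_def)
qed (auto intro: exI[of _ 0])

text \<open>After \<open>m i j\<close> steps the total angle is a full turn, so the displacement is
  orthogonal to both roots. It also lies in their span, so it is zero.\<close>

lemma reflect_comp_order: "((\<lambda>v. reflect i (reflect j v)) ^^ m i j) v = v"
proof (cases "i = j")
  case False
  define \<theta> where "\<theta> = pi / m i j"
  define w where "w = ((\<lambda>v. reflect i (reflect j v)) ^^ m i j) v"
  have full: "2 * real (m i j) * \<theta> = 2 * pi" using m_ge_2[OF False] by (simp add: \<theta>_def)
  have "sin \<theta> > 0"
    using pi_div_m[OF False] pi_gt_zero unfolding \<theta>_def by (intro sin_gt_zero) linarith+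
  moreover have "sin (2 * pi - \<theta>) = - sin \<theta>" by (simp add: sin_diff)
  moreover have "sin (2 * pi + \<theta>) = sin \<theta>" by (simp add: sin_add)
  ultimately have orth: "n i \<bullet> (w - v) = 0" "n j \<bullet> (w - v) = 0"
    using reflect_comp_funpow_inner[OF \<theta>_def False, of "m i j" v, unfolded full]
    by (simp_all add: w_def inner_diff_right)
  obtain a b where "w - v = a *\<^sub>R n i + b *\<^sub>R n j"
    using reflect_comp_funpow_span w_def by blast
  then have "(w - v) \<bullet> (w - v) = 0" using orth by (metis inner_add_left inner_scaleR_left mult_zero_right add_0)
  then show ?thesis by (simp add: w_def)
qed simp

text \<open>If some \<open>u\<close> in \<open>W\<close> is not orthogonal to \<open>n i\<close>,
  then \<open>u - reflect i u\<close> is a nonzero multiple of \<open>n i\<close>, so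
  \<open>n i\<close> lies in \<open>W\<close>. Hence roots in \<open>W\<close> are orthogonal to
  those outside, and irreducibility applies.\<close>

lemma invariant_subspace_full:
  assumes W: "subspace W" and inv: "\<And>i w. w \<in> W \<Longrightarrow> reflect i w \<in> W" and w: "w \<in> W" "w \<noteq> 0"
  shows "W = UNIV"
proof -
  define I where "I = {i. n i \<in> W}"
  have nmem: "n i \<in> W" if "u \<in> W" "n i \<bullet> u \<noteq> 0" for i u
  proof -
    have "u - reflect i u \<in> W" using that W inv by (intro subspace_diff) auto
    then have "(1 / (2 * (n i \<bullet> u))) *\<^sub>R (u - reflect i u) \<in> W" by (rule subspace_scale[OF W])
    then show ?thesis using that by (simp add: reflect_def)
  qed
  have "I = UNIV"
  proof (rule irreducible_split)
    show "n i \<bullet> n j = 0" if "i \<in> I" "j \<notin> I" for i j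
      using that nmem[of "n i" j] by (auto simp: I_def inner_commute)
    have "\<exists>i. n i \<bullet> w \<noteq> 0" using eq_0_if_orthogonal_roots w(2) by blast
    then show "I \<noteq> {}" using nmem[OF w(1)] by (auto simp: I_def)
  qed
  then have "root_comb y \<in> W" for y
    unfolding root_comb_def I_def by (intro subspace_sum subspace_scale W) auto
  then show ?thesis using root_comb_exists by (metis UNIV_eq_I)
qed

end

section \<open>The group action and eigenfunctions from orbits\<close>

locale coxeter_reflection = finite_coxeter G s m + simple_root_system m n
  for G :: "('g, 'b) monoid_scheme" (structure) and s :: "'n::finite \<Rightarrow> 'g" and m n
begin

definition word_action :: "('n \<times> bool) list \<Rightarrow> real ^ 'n \<Rightarrow> real ^ 'n" where
  "word_action w = foldr (\<lambda>l. reflect (fst l)) w"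

lemma word_action_simps [simp]:
  "word_action [] v = v" "word_action (l # w) v = reflect (fst l) (word_action w v)"
  "word_action (u @ w) v = word_action u (word_action w v)"
  by (simp_all add: word_action_def)

lemma word_action_cong:
  assumes "pres_equiv (coxeter_relators m) u v"
  shows "word_action u x = word_action v x"
  using assms
proof (induction arbitrary: x rule: pres_equiv.induct)
  case (relator r u v)
  obtain i j where r: "r = concat (replicate (m i j) [(i, True), (j, True)])"
    using relator by (auto simp: coxeter_relators_def)
  have "word_action (concat (replicate k [(i, True), (j, True)])) y = ((\<lambda>v. reflect i (reflect j v)) ^^ k) y" for k y
    by (induction k) simp_all
  then show ?case by (simp add: r reflect_comp_order)
qed simp_all

text \<open>The choice of a word is harmless: by \<open>word_action_cong\<close>, words for the same
  element act alike.\<close>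

definition action :: "'g \<Rightarrow> real ^ 'n \<Rightarrow> real ^ 'n" where
  "action g = word_action (SOME w. word_val G s w = g)"

lemma action_word_val: "action (word_val G s w) = word_action w"
proof -
  have "word_val G s (SOME u. word_val G s u = word_val G s w) = word_val G s w"
    by (rule someI) (rule HOL.refl)
  then show ?thesis
    unfolding action_def using word_val_eq_iff word_action_cong by blast
qed

lemma action_one: "action \<one> v = v"
  using action_word_val[of "[]"] by simp

lemma action_mult_s:
  assumes "g \<in> carrier G"
  shows "action (g \<otimes> s i) v = action g (reflect i v)"
proof -
  obtain w where w: "word_val G s w = g" using word_surj assms by blast
  have "word_val G s (w @ [(i, True)]) = g \<otimes> s i"
    by (simp add: word_val_append word_val_Cons w)
  then show ?thesis
    using action_word_val[of "w @ [(i, True)]"] action_word_val[of w] w by simp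
qed

lemma linear_action: "linear (action g)"
proof -
  have "linear (word_action w)" for w
  proof (induction w)
    case (Cons l w)
    have "word_action (l # w) = reflect (fst l) \<circ> word_action w" by (simp add: fun_eq_iff)
    then show ?case by (simp only: linear_compose[OF Cons linear_reflect])
  qed (auto intro: linearI)
  then show ?thesis by (simp add: action_def)
qed

text \<open>The vectors whose whole orbit is orthogonal to \<open>v\<close> form an invariant
  subspace containing \<open>p\<close>, hence everything, including \<open>v\<close> itself.\<close>

lemma orbit_spanning:
  assumes "\<And>g. g \<in> carrier G \<Longrightarrow> v \<bullet> action g p = 0" and "p \<noteq> 0"
  shows "v = 0"
proof -
  define W where "W = {w. \<forall>g\<in>carrier G. v \<bullet> action g w = 0}"
  have "W = UNIV"
  proof (rule invariant_subspace_full)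
    show "subspace W"
      unfolding W_def using linear_action
      by (intro subspaceI) (simp_all add: linear_0 linear_add linear_scale inner_add_right)
    show "reflect i w \<in> W" if "w \<in> W" for i w
      using that by (simp add: W_def flip: action_mult_s)
  qed (use assms in \<open>auto simp: W_def\<close>)
  then have "v \<bullet> action \<one> v = 0" by (auto simp: W_def)
  then show ?thesis by (simp add: action_one)
qed

text \<open>Applying \<open>action g\<close> to the vector equation and pairing with
  \<open>v\<close> turns it into the eigenvalue equation for \<open>F v\<close>. Injectivity in
  \<open>v\<close> is \<open>orbit_spanning\<close>.\<close>

lemma orbit_eigenvalue_mult:
  assumes p: "p \<noteq> 0" and eig: "(\<Sum>j\<in>UNIV. X $ j *\<^sub>R reflect j p) = \<mu> *\<^sub>R p"
  shows "CARD('n) \<le> cayley_mult G s X \<mu>"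
proof (rule cayley_mult_ge_CARD)
  define F where "F v g = (if g \<in> carrier G then v \<bullet> action g p else 0)" for v g
  show "F (v + w) = F v + F w" for v w by (simp add: F_def fun_eq_iff inner_add_left)
  show "F (c *\<^sub>R v) = (\<lambda>g. c * F v g)" for c v by (simp add: F_def fun_eq_iff)
  show "v = 0" if "F v = 0" for v
  proof (rule orbit_spanning[OF _ p])
    show "v \<bullet> action g p = 0" if "g \<in> carrier G" for g
      using \<open>F v = 0\<close> that by (metis F_def zero_fun_apply)
  qed
  show "F v \<in> cayley_eigenspace G s X \<mu>" for v
  proof -
    have "(\<Sum>j\<in>UNIV. X $ j * F v (g \<otimes> s j)) = \<mu> * F v g" if g: "g \<in> carrier G" for g
    proof -
      have "(\<Sum>j\<in>UNIV. X $ j * F v (g \<otimes> s j)) = v \<bullet> (\<Sum>j\<in>UNIV. X $ j *\<^sub>R action g (reflect j p))"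
        using g by (simp add: F_def action_mult_s inner_sum_right)
      also have "\<dots> = v \<bullet> action g (\<mu> *\<^sub>R p)"
        using linear_action[of g] by (simp add: linear_sum linear_scale flip: eig)
      also have "\<dots> = \<mu> * F v g"
        using g linear_action[of g] by (simp add: F_def linear_scale)
      finally show ?thesis .
    qed
    then show ?thesis by (auto simp: cayley_eigenspace_def cayley_op_def F_def fun_eq_iff)
  qed
qed

lemma sum_reflect:
  "(\<Sum>j\<in>UNIV. X $ j *\<^sub>R reflect j v) = (\<Sum>j\<in>UNIV. X $ j) *\<^sub>R v - 2 *\<^sub>R (\<Sum>j\<in>UNIV. (X $ j * (n j \<bullet> v)) *\<^sub>R n j)"
  by (simp add: reflect_def scaleR_right_diff_distrib sum_subtractf scaleR_sum_left scaleR_sum_right mult_ac)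

lemma interior_eigenvalue:
  assumes p: "p \<in> F0 n"
  shows "cayley_lambda G s 1 (Psi_Delta n p) = Psi_lambda n p"
    and "CARD('n) \<le> cayley_mult G s (Psi_Delta n p) (Psi_lambda n p)"
proof -
  define X where "X = Psi_Delta n p"
  have X: "X \<in> int_simplex" unfolding X_def by (rule Psi_Delta_mem[OF p])
  obtain y where y: "p = root_comb y" and pos: "\<And>j. n j \<bullet> root_comb y > 0"
    by (rule F0_obtain[OF p]) (rule that)
  define \<kappa> where "\<kappa> = 1 / coeff_ratio_sum y"
  have \<kappa>: "\<kappa> > 0" using coeff_ratio_sum_pos[OF pos] by (simp add: \<kappa>_def)
  have X_eq: "X $ j * (n j \<bullet> p) = \<kappa> * y $ j" for j
    using Psi_Delta_mult[OF pos] by (simp add: X_def y \<kappa>_def)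
  have lam: "Psi_lambda n p = 1 - 2 * \<kappa>" by (simp add: y Psi_lambda_eq[OF pos] \<kappa>_def)
  have "(\<Sum>j\<in>UNIV. X $ j *\<^sub>R reflect j p) = (1 - 2 * \<kappa>) *\<^sub>R p"
  proof -
    have "(\<Sum>j\<in>UNIV. (X $ j * (n j \<bullet> p)) *\<^sub>R n j) = \<kappa> *\<^sub>R p"
      unfolding X_eq by (simp add: y root_comb_def scaleR_sum_right)
    moreover have "(\<Sum>j\<in>UNIV. X $ j) = 1" using X by (simp add: int_simplex_def std_simplex_def)
    ultimately show ?thesis by (simp add: sum_reflect algebra_simps)
  qed
  moreover have "p \<noteq> 0" using p by (auto simp: mem_F0_iff)
  ultimately have mult: "CARD('n) \<le> cayley_mult G s X (1 - 2 * \<kappa>)"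
    by (intro orbit_eigenvalue_mult)
  then show "CARD('n) \<le> cayley_mult G s (Psi_Delta n p) (Psi_lambda n p)"
    by (simp add: X_def lam)
  have "cayley_lambda G s 1 X = 1 - 2 * \<kappa>"
  proof (rule cayley_lambda_1_interior[OF X])
    show "0 < cayley_mult G s X (1 - 2 * \<kappa>)" using mult by (metis zero_less_card_finite less_le_trans)
    \<comment> \<open>With these weights and \<open>X_eq\<close>, the required identity is
      \<open>\<kappa>\<close> times the expansion of \<open>n i \<bullet> p\<close> in root
      coordinates.\<close>
    show "\<mu> = 1 \<or> \<mu> \<le> 1 - 2 * \<kappa>" if "\<mu> \<in> cayley_eigenvalues G s X" for \<mu>
    proof (rule eigenvalue_gap[OF X that, of "\<lambda>j. n j \<bullet> p"])
      show "n i \<bullet> p > 0" for i using p by (simp add: mem_F0_iff)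
      show "X $ i * (n i \<bullet> p) - (\<Sum>j\<in>-{i}. cos (pi / m i j) * X $ j * (n j \<bullet> p)) = 2 * \<kappa> / 2 * (n i \<bullet> p)" for i
      proof -
        have "(\<Sum>j\<in>-{i}. cos (pi / m i j) * X $ j * (n j \<bullet> p)) = - \<kappa> * (\<Sum>j\<in>-{i}. y $ j * (n i \<bullet> n j))"
          unfolding sum_distrib_left
          by (intro sum.cong HOL.refl) (auto simp: root_inner X_eq mult.assoc)
        then show ?thesis by (simp add: X_eq) (simp add: y root_inner_root_comb algebra_simps)
      qed
    qed
  qed (use \<kappa> in simp)
  then show "cayley_lambda G s 1 (Psi_Delta n p) = Psi_lambda n p" by (simp add: X_def lam)
qed

text \<open>If \<open>x\<^sub>j = 0\<close>, then \<open>p\<^sub>j\<close> is fixed by all reflections that occur with a nonzero weight.\<close>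

lemma boundary_eigenvalue:
  assumes X: "X \<in> std_simplex" and j: "X $ j = 0"
  shows "cayley_lambda G s 1 X = 1" and "CARD('n) \<le> cayley_mult G s X 1"
proof -
  have sum: "(\<Sum>j\<in>UNIV. X $ j) = 1" using X by (simp add: std_simplex_def)
  define p where "p = dual_vec n j"
  have fixed: "X $ i * (n i \<bullet> p) = 0" for i using j by (simp add: p_def root_inner_dual_vec)
  have "(\<Sum>i\<in>UNIV. X $ i *\<^sub>R reflect i p) = 1 *\<^sub>R p" unfolding sum_reflect fixed sum by simp
  moreover have "n j \<bullet> p \<noteq> 0" using root_det_pos by (simp add: p_def root_inner_dual_vec)
  then have "p \<noteq> 0" by auto
  ultimately show mult: "CARD('n) \<le> cayley_mult G s X 1" by (intro orbit_eigenvalue_mult)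
  \<comment> \<open>A zero weight together with a nonzero one forces rank at least 2, so 1 occurs at
    least twice in the spectrum.\<close>
  obtain i where "X $ i \<noteq> 0" using sum by (metis sum.neutral zero_neq_one)
  then have "i \<noteq> j" using j by metis
  then have "card {i, j} = 2" by simp
  then have "2 \<le> CARD('n)" by (metis card_mono finite top_greatest)
  then show "cayley_lambda G s 1 X = 1" using mult by (intro cayley_lambda_1_eq_1[OF X]) simp
qed

lemma cayley_lambda_Psi:
  assumes X: "X \<in> int_simplex"
  shows "(Psi_lambda n \<circ> inv_into (F0 n) (Psi_Delta n)) X = cayley_lambda G s 1 X"
proof -
  have "X \<in> Psi_Delta n ` F0 n" using X bij_betw_Psi_Delta by (simp add: bij_betw_def)
  then show ?thesis
    using interior_eigenvalue(1)[of "inv_into (F0 n) (Psi_Delta n) X"]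
    by (simp add: inv_into_into f_inv_into_f)
qed

lemma cayley_mult_lambda_1:
  assumes X: "X \<in> std_simplex"
  shows "CARD('n) \<le> cayley_mult G s X (cayley_lambda G s 1 X)"
proof (cases "\<exists>j. X $ j = 0")
  case True
  then show ?thesis using boundary_eigenvalue[OF X] by force
next
  case False
  then have "X \<in> int_simplex" using X by (auto simp: int_simplex_def std_simplex_def less_le)
  then obtain p where "p \<in> F0 n" "Psi_Delta n p = X" using Psi_Delta_surj by blast
  then show ?thesis using interior_eigenvalue[of p] by simp
qed

end

theorem proposition1p9:
  fixes G :: "('g, 'b) monoid_scheme"
    and s :: "'n::finite \<Rightarrow> 'g"
    and m :: "'n \<Rightarrow> 'n \<Rightarrow> nat"
    and n :: "'n \<Rightarrow> real ^ 'n"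
  assumes "coxeter_system G s m"
    and "finite (carrier G)"
    and "irreducible_coxeter m"
    and "simple_roots m n"
  shows "bij_betw (Psi_Delta n) (F0 n) int_simplex
    \<and> (CARD('n) \<ge> 2 \<longrightarrow>
         Psi_lambda n \<in> F0 n \<rightarrow> {0<..<1} \<and>
         cayley_lambda G s 1 \<in> int_simplex \<rightarrow> {0<..<1})
    \<and> (\<forall>X\<in>int_simplex.
         (Psi_lambda n \<circ> inv_into (F0 n) (Psi_Delta n)) X = cayley_lambda G s 1 X)
    \<and> (\<forall>X\<in>std_simplex. cayley_mult G s X (cayley_lambda G s 1 X) \<ge> CARD('n))"
proof -
  interpret group G using assms(1) by (simp add: coxeter_system_def presented_by_def)
  interpret coxeter_reflection G s m n
    using assms by unfold_locales (simp_all add: coxeter_system_def)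
  have "cayley_lambda G s 1 X \<in> {0<..<1}" if "X \<in> int_simplex" "CARD('n) \<ge> 2" for X
    using Psi_Delta_surj[OF that(1)] interior_eigenvalue(1) Psi_lambda_mem[OF _ that(2)] by metis
  then show ?thesis
    using bij_betw_Psi_Delta Psi_lambda_mem cayley_lambda_Psi cayley_mult_lambda_1 by blast
qed

end
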